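(* Let $\Sigma=(A,G,\alpha,\sigma)$ be a unital discrete twisted C$^*$-dynamical system and let $T\in L(\Sigma)$ be positive definite with respect to $\Sigma$. Then: (1) There exist an equivariant representation $(\rho,v)$ of $\Sigma$ on a Hilbert $A$-module $X$ and $x\in X$ such that $T=T_{\rho,v,x,x}$. (2) The vector $x\in X$ may be chosen to be cyclic for $(\rho,v)$, that is, such that $\mathrm{Span}\{(\rho(a)v(g)x)\cdot b \mid a,b\in A,\ g\in G\}$ is dense in $X$. (3) If (with $x$ cyclic for $(\rho,v)$ as in (2)) we also have $T=T_{\rho',v',x',x'}$ for some equivariant representation $(\rho',v')$ of $\Sigma$ on a Hilbert $A$-module $X'$ and some $x'\in X'$ which is cyclic for $(\rho',v')$, then the triple $(\rho',v',x')$ is unitarily equivalent to the triple $(\rho,v,x)$, in the sense that there exists a unitary $u\in\mathcal{L}(X,X')$ such that $\rho'(a)=u\rho(a)u^*$, $v'(g)=u\,v(g)\,u^*$ and $u\,x=x'$ for all $a\in A$ and $g\in G$.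
   Context: Conventions: all C$^*$-algebras are unital and homomorphisms between them are unital and $*$-preserving. $\Sigma=(A,G,\alpha,\sigma)$ is a unital discrete twisted C$^*$-dynamical system: $A$ is a C$^*$-algebra with unit $1$, $G$ is a discrete group with identity $e$, $\alpha:G\to \mathrm{Aut}(A)$ and $\sigma:G\times G\to \mathcal{U}(A)$ (the unitary group of $A$) are maps satisfying $\alpha_g\alpha_h=\mathrm{Ad}(\sigma(g,h))\,\alpha_{gh}$, $\sigma(g,h)\sigma(gh,k)=\alpha_g(\sigma(h,k))\sigma(g,hk)$ and $\sigma(g,e)=\sigma(e,g)=1$ for all $g,h,k\in G$. Hilbert $A$-modules are right modules, with $A$-valued inner product linear in the second variable; $\mathcal{L}(X,X')$ denotes the adjointable operators from $X$ to $X'$, and $\mathcal{L}(X)=\mathcal{L}(X,X)$. An equivariant representation of $\Sigma$ on a Hilbert $A$-module $X$ is a pair $(\rho,v)$ where $\rho:A\to\mathcal{L}(X)$ is a (unital $*$-) homomorphism and $v:G\to\mathcal{I}(X)$ is a map into the group of $\mathbb{C}$-linear, invertible, bounded maps $X\to X$, such that for all $g,h\in G$, $a\in A$, $x,x'\in X$: (i) $\rho(\alpha_g(a))=v(g)\rho(a)v(g)^{-1}$; (ii) $v(g)v(h)=\mathrm{ad}_\rho(\sigma(g,h))\,v(gh)$, where $\mathrm{ad}_\rho(\sigma(g,h))x=(\rho(\sigma(g,h))x)\cdot\sigma(g,h)^*$; (iii) $\alpha_g(\langle x,x'\rangle)=\langle v(g)x,v(g)x'\rangle$; (iv) $v(g)(x\cdot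 a)=(v(g)x)\cdot\alpha_g(a)$. $L(\Sigma)$ is the set of all maps $T:G\times A\to A$ that are linear in the second variable; write $T_g(a)=T(g,a)$. For $(\rho,v)$ on $X$ and $x,y\in X$, $T_{\rho,v,x,y}\in L(\Sigma)$ is defined by $T_{\rho,v,x,y}(g,a)=\langle x,\rho(a)v(g)y\rangle$. $T\in L(\Sigma)$ is positive definite (w.r.t. $\Sigma$) if for any $n\in\mathbb{N}$, $g_1,\dots,g_n\in G$ and $a_1,\dots,a_n\in A$, the matrix $\Big[\alpha_{g_i}\Big(T_{g_i^{-1}g_j}\big(\alpha_{g_i}^{-1}(a_i^*a_j\,\sigma(g_i,g_i^{-1}g_j)^* )\big)\Big)\,\sigma(g_i,g_i^{-1}g_j)\Big]_{i,j}$ is positive in $M_n(A)$. *)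

theory Defs
  imports "HOL-Analysis.Analysis" "HOL-Library.Function_Algebras"
begin

section \<open>Unital C*-algebras\<close>

text \<open>
  The complex scalar multiplication extends the real one of the library. The class builds on
  \<^class>\<open>real_normed_algebra\<close> and \<^class>\<open>monoid_mult\<close> rather than on \<^class>\<open>real_normed_algebra_1\<close>,
  so that the zero algebra is admitted. If \<open>1 \<noteq> 0\<close>, then \<open>norm 1 = 1\<close> follows from the C*-identity.
\<close>

class unital_cstar_algebra = real_normed_algebra + monoid_mult + banach +
  fixes scaleC :: "complex \<Rightarrow> 'a \<Rightarrow> 'a"  (infixr "*\<^sub>C" 75)
    and star :: "'a \<Rightarrow> 'a"
  assumes scaleC_add_right: "c *\<^sub>C (x + y) = c *\<^sub>C x + c *\<^sub>C y"
    and scaleC_add_left: "(c + d) *\<^sub>C x = c *\<^sub>C x + d *\<^sub>C x"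
    and scaleC_scaleC: "c *\<^sub>C d *\<^sub>C x = (c * d) *\<^sub>C x"
    and scaleR_scaleC: "r *\<^sub>R x = complex_of_real r *\<^sub>C x"
    and mult_scaleC_left: "(c *\<^sub>C x) * y = c *\<^sub>C (x * y)"
    and mult_scaleC_right: "x * (c *\<^sub>C y) = c *\<^sub>C (x * y)"
    and norm_scaleC: "norm (c *\<^sub>C x) = cmod c * norm x"
    and star_add: "star (x + y) = star x + star y"
    and star_scaleC: "star (c *\<^sub>C x) = cnj c *\<^sub>C star x"
    and star_mult: "star (x * y) = star y * star x"
    and star_star: "star (star x) = x"
    and cstar_identity: "norm (star x * x) = (norm x)\<^sup>2"
begin

definition unitary_element :: "'a \<Rightarrow> bool" where
  "unitary_element w \<longleftrightarrow> star w * w = 1 \<and> w * star w = 1"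

definition positive_element :: "'a \<Rightarrow> bool" where
  "positive_element a \<longleftrightarrow> (\<exists>b. a = star b * b)"

text \<open>
  Positivity of the \<open>n \<times> n\<close> matrix with entries \<open>M i j\<close> (\<open>i, j < n\<close>) in the C*-algebra
  \<open>M\<^sub>n(A)\<close>, i.e. \<open>M = B\<^sup>* B\<close> for some \<open>B\<close> in \<open>M\<^sub>n(A)\<close>, where \<open>(B\<^sup>*)\<^sub>i\<^sub>k = (B\<^sub>k\<^sub>i)\<^sup>*\<close>.
\<close>

definition positive_matrix :: "nat \<Rightarrow> (nat \<Rightarrow> nat \<Rightarrow> 'a) \<Rightarrow> bool" where
  "positive_matrix n M \<longleftrightarrow>
     (\<exists>B. \<forall>i<n. \<forall>j<n. M i j = (\<Sum>k<n. star (B k i) * B k j))"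

end

lemma vector_space_scaleC:
  "vector_space (scaleC :: complex \<Rightarrow> 'a::unital_cstar_algebra \<Rightarrow> 'a)"
proof
  fix x :: 'a
  show "1 *\<^sub>C x = x"
    using scaleR_scaleC[of 1 x] by simp
qed (simp_all add: scaleC_add_right scaleC_add_left scaleC_scaleC)

abbreviation complex_linear :: "('a::unital_cstar_algebra \<Rightarrow> 'a) \<Rightarrow> bool" where
  "complex_linear \<equiv> Vector_Spaces.linear scaleC scaleC"

definition star_automorphism :: "('a::unital_cstar_algebra \<Rightarrow> 'a) \<Rightarrow> bool" where
  "star_automorphism \<phi> \<longleftrightarrow>
     complex_linear \<phi> \<and> (\<forall>a b. \<phi> (a * b) = \<phi> a * \<phi> b) \<and> \<phi> 1 = 1 \<and>
     (\<forall>a. \<phi> (star a) = star (\<phi> a)) \<and> bij \<phi>"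


section \<open>Twisted C*-dynamical systems\<close>

text \<open>
  The discrete group \<open>G\<close> is a type of class \<^class>\<open>group_add\<close>, the library's class of groups that
  need not be commutative. Hence \<open>gh\<close>, \<open>g\<^sup>-\<^sup>1\<close> and \<open>e\<close> are written \<open>g + h\<close>, \<open>- g\<close> and \<open>0\<close>.
\<close>

locale twisted_system =
  fixes \<alpha> :: "'g::group_add \<Rightarrow> 'a::unital_cstar_algebra \<Rightarrow> 'a"
    and \<sigma> :: "'g \<Rightarrow> 'g \<Rightarrow> 'a"
  assumes action_automorphism: "star_automorphism (\<alpha> g)"
    and cocycle_unitary: "unitary_element (\<sigma> g h)"
    and twisted_action: "\<alpha> g (\<alpha> h a) = \<sigma> g h * \<alpha> (g + h) a * star (\<sigma> g h)"
    and cocycle: "\<sigma> g h * \<sigma> (g + h) k = \<alpha> g (\<sigma> h k) * \<sigma> g (h + k)"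
    and cocycle_right_unit: "\<sigma> g 0 = 1"
    and cocycle_left_unit: "\<sigma> 0 g = 1"

definition L_maps :: "('g::group_add \<Rightarrow> 'a::unital_cstar_algebra \<Rightarrow> 'a) set" where
  "L_maps = {T. \<forall>g. complex_linear (T g)}"

definition positive_definite ::
  "('g::group_add \<Rightarrow> 'a::unital_cstar_algebra \<Rightarrow> 'a) \<Rightarrow> ('g \<Rightarrow> 'g \<Rightarrow> 'a) \<Rightarrow>
   ('g \<Rightarrow> 'a \<Rightarrow> 'a) \<Rightarrow> bool" where
  "positive_definite \<alpha> \<sigma> T \<longleftrightarrow>
     (\<forall>(n::nat) (g :: nat \<Rightarrow> 'g) (a :: nat \<Rightarrow> 'a).
        positive_matrix n (\<lambda>i j.
          \<alpha> (g i) (T (- g i + g j)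
            (inv (\<alpha> (g i)) (star (a i) * a j * star (\<sigma> (g i) (- g i + g j)))))
          * \<sigma> (g i) (- g i + g j)))"


section \<open>Hilbert modules\<close>

text \<open>
  A Hilbert module has an explicit carrier, so that one can assert the existence of a module over
  a given algebra. The carrier sits inside a type of class \<^class>\<open>ab_group_add\<close>, which supplies
  addition and zero. The operations are only constrained on the carrier. For carriers that consist
  of functions, addition is pointwise (\<^theory>\<open>HOL-Library.Function_Algebras\<close>).
\<close>

record ('x, 'a) hmod =
  hcarrier :: "'x set"
  hscale :: "complex \<Rightarrow> 'x \<Rightarrow> 'x"
  hact :: "'x \<Rightarrow> 'a \<Rightarrow> 'x"
  hip :: "'x \<Rightarrow> 'x \<Rightarrow> 'a"

definition hnorm :: "('x, 'a::unital_cstar_algebra) hmod \<Rightarrow> 'x \<Rightarrow> real" where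
  "hnorm X x = sqrt (norm (hip X x x))"

locale hilbert_module =
  fixes X :: "('x::ab_group_add, 'a::unital_cstar_algebra) hmod"
  assumes zero_closed: "0 \<in> hcarrier X"
    and add_closed: "\<lbrakk>x \<in> hcarrier X; y \<in> hcarrier X\<rbrakk> \<Longrightarrow> x + y \<in> hcarrier X"
    and scale_closed: "x \<in> hcarrier X \<Longrightarrow> hscale X c x \<in> hcarrier X"
    and act_closed: "x \<in> hcarrier X \<Longrightarrow> hact X x a \<in> hcarrier X"
    and scale_add_right: "\<lbrakk>x \<in> hcarrier X; y \<in> hcarrier X\<rbrakk> \<Longrightarrow>
          hscale X c (x + y) = hscale X c x + hscale X c y"
    and scale_add_left: "x \<in> hcarrier X \<Longrightarrow> hscale X (c + d) x = hscale X c x + hscale X d x"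
    and scale_scale: "x \<in> hcarrier X \<Longrightarrow> hscale X c (hscale X d x) = hscale X (c * d) x"
    and scale_one: "x \<in> hcarrier X \<Longrightarrow> hscale X 1 x = x"
    and act_add_left: "\<lbrakk>x \<in> hcarrier X; y \<in> hcarrier X\<rbrakk> \<Longrightarrow>
          hact X (x + y) a = hact X x a + hact X y a"
    and act_add_right: "x \<in> hcarrier X \<Longrightarrow> hact X x (a + b) = hact X x a + hact X x b"
    and act_act: "x \<in> hcarrier X \<Longrightarrow> hact X (hact X x a) b = hact X x (a * b)"
    and act_one: "x \<in> hcarrier X \<Longrightarrow> hact X x 1 = x"
    and act_scale_left: "x \<in> hcarrier X \<Longrightarrow> hact X (hscale X c x) a = hscale X c (hact X x a)"
    and act_scale_right: "x \<in> hcarrier X \<Longrightarrow> hact X x (c *\<^sub>C a) = hscale X c (hact X x a)"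
    and ip_add: "\<lbrakk>x \<in> hcarrier X; y \<in> hcarrier X; z \<in> hcarrier X\<rbrakk> \<Longrightarrow>
          hip X x (y + z) = hip X x y + hip X x z"
    and ip_scale: "\<lbrakk>x \<in> hcarrier X; y \<in> hcarrier X\<rbrakk> \<Longrightarrow>
          hip X x (hscale X c y) = c *\<^sub>C hip X x y"
    and ip_act: "\<lbrakk>x \<in> hcarrier X; y \<in> hcarrier X\<rbrakk> \<Longrightarrow>
          hip X x (hact X y a) = hip X x y * a"
    and ip_star: "\<lbrakk>x \<in> hcarrier X; y \<in> hcarrier X\<rbrakk> \<Longrightarrow> hip X y x = star (hip X x y)"
    and ip_positive: "x \<in> hcarrier X \<Longrightarrow> positive_element (hip X x x)"
    and ip_definite: "\<lbrakk>x \<in> hcarrier X; hip X x x = 0\<rbrakk> \<Longrightarrow> x = 0"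
    and complete: "\<lbrakk>\<And>n::nat. s n \<in> hcarrier X;
           \<And>\<epsilon>. 0 < \<epsilon> \<Longrightarrow> \<exists>N. \<forall>m\<ge>N. \<forall>n\<ge>N. hnorm X (s m - s n) < \<epsilon>\<rbrakk> \<Longrightarrow>
          \<exists>x\<in>hcarrier X. (\<lambda>n. hnorm X (s n - x)) \<longlonglongrightarrow> 0"

definition hspan :: "('x::ab_group_add, 'a) hmod \<Rightarrow> 'x set \<Rightarrow> 'x set" where
  "hspan X S = {\<Sum>i<n. hscale X (c i) (s i) | (n::nat) c s. \<forall>i<n. s i \<in> S}"

definition hdense :: "('x::ab_group_add, 'a::unital_cstar_algebra) hmod \<Rightarrow> 'x set \<Rightarrow> bool" where
  "hdense X D \<longleftrightarrow> (\<forall>y\<in>hcarrier X. \<forall>\<epsilon>>0. \<exists>z\<in>D. hnorm X (y - z) < \<epsilon>)"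

text \<open>
  \<open>is_adjoint X Y f f'\<close> says that \<open>f\<close> belongs to \<open>\<L>(X, Y)\<close> and that \<open>f'\<close> is its adjoint; this
  forces \<open>f\<close> and \<open>f'\<close> to be linear, \<open>A\<close>-linear and bounded.
\<close>

definition is_adjoint ::
  "('x, 'a) hmod \<Rightarrow> ('y, 'a) hmod \<Rightarrow> ('x \<Rightarrow> 'y) \<Rightarrow> ('y \<Rightarrow> 'x) \<Rightarrow> bool" where
  "is_adjoint X Y f f' \<longleftrightarrow>
     f \<in> hcarrier X \<rightarrow> hcarrier Y \<and> f' \<in> hcarrier Y \<rightarrow> hcarrier X \<and>
     (\<forall>x\<in>hcarrier X. \<forall>y\<in>hcarrier Y. hip Y (f x) y = hip X x (f' y))"

definition is_unitary ::
  "('x, 'a) hmod \<Rightarrow> ('y, 'a) hmod \<Rightarrow> ('x \<Rightarrow> 'y) \<Rightarrow> ('y \<Rightarrow> 'x) \<Rightarrow> bool" where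
  "is_unitary X Y u u' \<longleftrightarrow> is_adjoint X Y u u' \<and>
     (\<forall>x\<in>hcarrier X. u' (u x) = x) \<and> (\<forall>y\<in>hcarrier Y. u (u' y) = y)"

text \<open>
  The group \<open>\<I>(X)\<close>; the inverse of such a map is automatically bounded, by the open mapping theorem.
\<close>

definition invertible_bounded ::
  "('x::ab_group_add, 'a::unital_cstar_algebra) hmod \<Rightarrow> ('x \<Rightarrow> 'x) \<Rightarrow> bool" where
  "invertible_bounded X f \<longleftrightarrow>
     bij_betw f (hcarrier X) (hcarrier X) \<and>
     (\<forall>x\<in>hcarrier X. \<forall>y\<in>hcarrier X. f (x + y) = f x + f y) \<and>
     (\<forall>c. \<forall>x\<in>hcarrier X. f (hscale X c x) = hscale X c (f x)) \<and>
     (\<exists>K. \<forall>x\<in>hcarrier X. hnorm X (f x) \<le> K * hnorm X x)"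


section \<open>Equivariant representations\<close>

locale equivariant_rep = twisted_system \<alpha> \<sigma> + hilbert_module X
  for \<alpha> :: "'g::group_add \<Rightarrow> 'a::unital_cstar_algebra \<Rightarrow> 'a"
    and \<sigma> :: "'g \<Rightarrow> 'g \<Rightarrow> 'a"
    and X :: "('x::ab_group_add, 'a) hmod" +
  fixes \<rho> :: "'a \<Rightarrow> 'x \<Rightarrow> 'x"
    and v :: "'g \<Rightarrow> 'x \<Rightarrow> 'x"
  assumes rho_star: "is_adjoint X X (\<rho> a) (\<rho> (star a))"
    and rho_add: "x \<in> hcarrier X \<Longrightarrow> \<rho> (a + b) x = \<rho> a x + \<rho> b x"
    and rho_scale: "x \<in> hcarrier X \<Longrightarrow> \<rho> (c *\<^sub>C a) x = hscale X c (\<rho> a x)"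
    and rho_mult: "x \<in> hcarrier X \<Longrightarrow> \<rho> (a * b) x = \<rho> a (\<rho> b x)"
    and rho_one: "x \<in> hcarrier X \<Longrightarrow> \<rho> 1 x = x"
    and v_invertible: "invertible_bounded X (v g)"
    and rho_covariant: "x \<in> hcarrier X \<Longrightarrow>
          \<rho> (\<alpha> g a) x = v g (\<rho> a (inv_into (hcarrier X) (v g) x))"
    and v_twisted: "x \<in> hcarrier X \<Longrightarrow>
          v g (v h x) = hact X (\<rho> (\<sigma> g h) (v (g + h) x)) (star (\<sigma> g h))"
    and v_ip: "\<lbrakk>x \<in> hcarrier X; y \<in> hcarrier X\<rbrakk> \<Longrightarrow> \<alpha> g (hip X x y) = hip X (v g x) (v g y)"
    and v_act: "x \<in> hcarrier X \<Longrightarrow> v g (hact X x a) = hact X (v g x) (\<alpha> g a)"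

definition coefficient ::
  "('x, 'a) hmod \<Rightarrow> ('a \<Rightarrow> 'x \<Rightarrow> 'x) \<Rightarrow> ('g \<Rightarrow> 'x \<Rightarrow> 'x) \<Rightarrow> 'x \<Rightarrow> 'x \<Rightarrow> 'g \<Rightarrow> 'a \<Rightarrow> 'a" where
  "coefficient X \<rho> v x y g a = hip X x (\<rho> a (v g y))"

definition cyclic ::
  "('x::ab_group_add, 'a::unital_cstar_algebra) hmod \<Rightarrow> ('a \<Rightarrow> 'x \<Rightarrow> 'x) \<Rightarrow> ('g \<Rightarrow> 'x \<Rightarrow> 'x) \<Rightarrow>
   'x \<Rightarrow> bool" where
  "cyclic X \<rho> v x \<longleftrightarrow> hdense X (hspan X {hact X (\<rho> a (v g x)) b | a b g. True})"

definition unitarily_equivalent ::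
  "('x, 'a) hmod \<Rightarrow> ('a \<Rightarrow> 'x \<Rightarrow> 'x) \<Rightarrow> ('g \<Rightarrow> 'x \<Rightarrow> 'x) \<Rightarrow> 'x \<Rightarrow>
   ('y, 'a) hmod \<Rightarrow> ('a \<Rightarrow> 'y \<Rightarrow> 'y) \<Rightarrow> ('g \<Rightarrow> 'y \<Rightarrow> 'y) \<Rightarrow> 'y \<Rightarrow> bool" where
  "unitarily_equivalent X \<rho> v x X' \<rho>' v' x' \<longleftrightarrow>
     (\<exists>u u'. is_unitary X X' u u' \<and>
        (\<forall>a. \<forall>y\<in>hcarrier X'. \<rho>' a y = u (\<rho> a (u' y))) \<and>
        (\<forall>g. \<forall>y\<in>hcarrier X'. v' g y = u (v g (u' y))) \<and>
        u x = x')"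

end

theory Submission
  imports Defs
begin

text \<open>
  The theorem is a GNS construction. Put \<open>e(g, a) = \<rho>(a) v(g) x\<close>. The axioms of an equivariant
  representation express the inner products of these vectors through the function \<open>T\<^sub>\<rho>\<^sub>,\<^sub>v\<^sub>,\<^sub>x\<^sub>,\<^sub>x\<close> alone
  (\<open>inner_orbit\<close>), and the resulting kernel is the matrix whose positivity defines positive
  definiteness. So a positive definite \<open>T\<close> is the same thing as a positive \<open>A\<close>-valued kernel on
  \<open>G \<times> A\<close> of the right shape, and the triple \<open>(\<rho>, v, x)\<close> has to be recovered from its kernel.

  Uniqueness. A vector \<open>y\<close> of a module with a cyclic vector is determined by the function
  \<open>(g, a) \<mapsto> \<langle>e(g, a), y\<rangle>\<close>. Two cyclic triples with the same \<open>T\<close> have total families with the same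
  Gram matrix, hence there is a unitary that matches these functions (\<open>is_unitary_transport\<close>). It
  intertwines the representations, because passing from \<open>y\<close> to \<open>\<rho>(c) y\<close> or \<open>v(h) y\<close> changes the
  function of \<open>y\<close> by a formula that involves only \<open>\<Sigma>\<close> (\<open>inner_rho_orbit\<close>, \<open>inner_v_orbit\<close>).

  Existence. These formulas also say what to do if no module is given: realise the module as a
  space of functions on \<open>G \<times> A\<close>, and let \<open>\<rho>(c)\<close> and \<open>v(h)\<close> act on all functions by the formulas.
  The functions \<open>K(\<cdot>, s) b\<close> span an inner product module, which is completed inside the functions by
  pointwise limits of Cauchy sequences (\<open>hilbert_kernel_module\<close>). The cocycle identity makes the
  kernel invariant under translation (\<open>twisted_kernel_shift\<close>), so that \<open>v(h)\<close> is isometric up to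
  \<open>\<alpha>\<^sub>h\<close> and passes to the completion. The operator \<open>\<rho>(c)\<close> is bounded on the span
  because \<open>c\<^sup>* c \<le> \<parallel>c\<parallel>\<^sup>2\<close>, so it passes to the completion as well.

  The analysis behind both parts is the order of the C*-algebra \<open>A\<close>: the elements \<open>b\<^sup>* b\<close> form a
  closed convex cone on which the norm is monotone. This gives positivity of the inner product on
  the completion, the Cauchy-Schwarz inequality, and the contractivity of *-automorphisms. The proof
  here avoids spectra: it only uses square roots of \<open>1 - x\<close> for \<open>\<parallel>x\<parallel> \<le> 1\<close>, and the fact that
  \<open>c + i \<surd>(1 - c\<^sup>2)\<close> is unitary for a self-adjoint contraction \<open>c\<close>.
\<close>

section \<open>Positive elements of a C*-algebra\<close>

lemma star_zero [simp]: "star (0::'a::unital_cstar_algebra) = 0"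
  using star_add[of 0 "0::'a"] by simp

lemma star_minus: "star (- x) = - star (x::'a::unital_cstar_algebra)"
  using star_add[of x "-x"] by (simp add: eq_neg_iff_add_eq_0 add.commute)

lemma star_diff: "star (x - y) = star x - star (y::'a::unital_cstar_algebra)"
  using star_add[of x "-y"] by (simp add: star_minus)

lemma star_one [simp]: "star (1::'a::unital_cstar_algebra) = 1"
  using star_mult[of "star 1" "1::'a"] by (simp add: star_star)

lemma star_scaleR: "star (r *\<^sub>R x) = r *\<^sub>R star (x::'a::unital_cstar_algebra)"
  by (simp add: scaleR_scaleC star_scaleC)

lemma star_sum: "star (sum f S) = (\<Sum>i\<in>S. star (f i :: 'a::unital_cstar_algebra))"
  by (induction S rule: infinite_finite_induct) (simp_all add: star_add)

lemma norm_star: "norm (star x) = norm (x::'a::unital_cstar_algebra)"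
proof -
  have le: "norm y \<le> norm (star y)" for y :: 'a
  proof (cases "y = 0")
    case False
    have "norm y * norm y \<le> norm (star y) * norm y"
      using norm_mult_ineq[of "star y" y] by (simp add: cstar_identity power2_eq_square)
    with False show ?thesis by simp
  qed simp
  show ?thesis using le[of x] le[of "star x"] by (simp add: star_star)
qed

lemma norm_one_le: "norm (1::'a::unital_cstar_algebra) \<le> 1"
  using cstar_identity[of "1::'a"] by (auto simp: power2_eq_square)

lemma star_mult_self_eq_zero: "star x * x = 0 \<Longrightarrow> x = (0::'a::unital_cstar_algebra)"
  using cstar_identity[of x] by simp

lemma selfadjoint_square_eq_zero: "star x = x \<Longrightarrow> x * x = 0 \<Longrightarrow> x = (0::'a::unital_cstar_algebra)"
  using star_mult_self_eq_zero[of x] by simp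

lemma bounded_linear_star: "bounded_linear (star :: 'a::unital_cstar_algebra \<Rightarrow> 'a)"
  by (rule bounded_linear_intro[of _ 1]) (simp_all add: star_add star_scaleR norm_star)

lemmas tendsto_star = bounded_linear.tendsto[OF bounded_linear_star]

lemma bounded_linear_scaleC: "bounded_linear (scaleC c :: 'a::unital_cstar_algebra \<Rightarrow> 'a)"
  by (rule bounded_linear_intro[of _ "cmod c"])
    (simp_all add: scaleC_add_right norm_scaleC scaleR_scaleC scaleC_scaleC mult.commute)

lemma scaleC_one_left: "1 *\<^sub>C x = (x::'a::unital_cstar_algebra)"
  using scaleR_scaleC[of 1 x] by simp

lemma scaleC_minus_left: "(- c) *\<^sub>C x = - (c *\<^sub>C (x::'a::unital_cstar_algebra))"
proof -
  have "(0::complex) *\<^sub>C x = 0" using scaleR_scaleC[of 0 x] by simp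
  then show ?thesis
    using scaleC_add_left[of "-c" c x] by (simp add: eq_neg_iff_add_eq_0)
qed

lemma scaleC_minus_right: "c *\<^sub>C (- x) = - (c *\<^sub>C (x::'a::unital_cstar_algebra))"
  by (rule linear_neg[OF bounded_linear.linear[OF bounded_linear_scaleC]])

lemma scaleC_diff_right: "c *\<^sub>C (x - y) = c *\<^sub>C x - c *\<^sub>C (y::'a::unital_cstar_algebra)"
  by (rule linear_diff[OF bounded_linear.linear[OF bounded_linear_scaleC]])

text \<open>
  The iteration \<open>y \<mapsto> (x + y\<^sup>2) / 2\<close> converges to \<open>1 - \<surd>(1 - x)\<close> if \<open>\<parallel>x\<parallel> \<le> 1\<close>. Its iterates are
  polynomials in \<open>x\<close> with nonnegative coefficients, so the scalar iteration with \<open>x = 1\<close> dominates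
  them and also their differences.
\<close>

primrec sqrt_majorant :: "nat \<Rightarrow> real" where
  "sqrt_majorant 0 = 0"
| "sqrt_majorant (Suc n) = (1 + sqrt_majorant n * sqrt_majorant n) / 2"

primrec sqrt_iterate :: "'a::unital_cstar_algebra \<Rightarrow> nat \<Rightarrow> 'a" where
  "sqrt_iterate x 0 = 0"
| "sqrt_iterate x (Suc n) = (1/2) *\<^sub>R (x + sqrt_iterate x n * sqrt_iterate x n)"

lemma sqrt_majorant_bounds: "0 \<le> sqrt_majorant n \<and> sqrt_majorant n \<le> 1"
proof (induction n)
  case (Suc n)
  then show ?case using mult_le_one[of "sqrt_majorant n" "sqrt_majorant n"] by auto
qed simp

lemma sqrt_majorant_Suc: "sqrt_majorant n \<le> sqrt_majorant (Suc n)"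
  using zero_le_square[of "sqrt_majorant n - 1"] by (simp add: algebra_simps)

lemma sqrt_iterate_commute: "z * x = x * z \<Longrightarrow> z * sqrt_iterate x n = sqrt_iterate x n * z"
proof (induction n)
  case (Suc n)
  then have "z * (sqrt_iterate x n * sqrt_iterate x n) = sqrt_iterate x n * sqrt_iterate x n * z"
    by (metis mult.assoc)
  with Suc.prems show ?case by (simp add: distrib_left distrib_right)
qed simp

lemma sqrt_iterate_star: "star x = x \<Longrightarrow> star (sqrt_iterate x n) = sqrt_iterate x n"
  by (induction n) (simp_all add: star_scaleR star_add star_mult)

lemma norm_sqrt_iterate:
  assumes "norm x \<le> 1"
  shows "norm (sqrt_iterate x n) \<le> sqrt_majorant n"
proof (induction n)
  case (Suc n)
  have "norm (x + sqrt_iterate x n * sqrt_iterate x n) \<le> norm x + norm (sqrt_iterate x n * sqrt_iterate x n)"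
    by (rule norm_triangle_ineq)
  also have "\<dots> \<le> 1 + sqrt_majorant n * sqrt_majorant n"
    using assms norm_mult_ineq[of "sqrt_iterate x n" "sqrt_iterate x n"]
      mult_mono[OF Suc Suc] sqrt_majorant_bounds[of n] by auto
  finally show ?case by simp
qed simp

text \<open>
  Consecutive differences factor as \<open>(y' + y) (y' - y) / 2\<close>, since the iterates commute, and the
  majorant satisfies the same recursion with equality.
\<close>

lemma norm_sqrt_iterate_Suc_diff:
  assumes "norm x \<le> 1"
  shows "norm (sqrt_iterate x (Suc n) - sqrt_iterate x n) \<le> sqrt_majorant (Suc n) - sqrt_majorant n"
proof (induction n)
  case 0
  show ?case using assms by simp
next
  case (Suc n)
  let ?y = "sqrt_iterate x" and ?r = sqrt_majorant
  have xc: "?y n * x = x * ?y n" using sqrt_iterate_commute[of x x n] by simp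
  have c: "?y n * ?y (Suc n) = ?y (Suc n) * ?y n"
    by (rule sqrt_iterate_commute[OF xc])
  have "?y (Suc (Suc n)) - ?y (Suc n)
      = (1/2) *\<^sub>R (?y (Suc n) * ?y (Suc n) - ?y n * ?y n)"
    by (simp only: sqrt_iterate.simps(2)[of x "Suc n"] sqrt_iterate.simps(2)[of x n, symmetric])
      (simp add: algebra_simps)
  also have "\<dots> = (1/2) *\<^sub>R ((?y (Suc n) + ?y n) * (?y (Suc n) - ?y n))"
    unfolding distrib_right right_diff_distrib c by simp
  also have "norm \<dots> \<le> (1/2) * ((?r (Suc n) + ?r n) * (?r (Suc n) - ?r n))"
  proof -
    have "norm ((?y (Suc n) + ?y n) * (?y (Suc n) - ?y n))
        \<le> norm (?y (Suc n) + ?y n) * norm (?y (Suc n) - ?y n)"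
      by (rule norm_mult_ineq)
    also have "\<dots> \<le> (?r (Suc n) + ?r n) * (?r (Suc n) - ?r n)"
      by (intro mult_mono Suc norm_triangle_le add_mono norm_sqrt_iterate assms)
        (use sqrt_majorant_bounds[of n] sqrt_majorant_bounds[of "Suc n"] in auto)
    finally show ?thesis by simp
  qed
  also have "\<dots> = ?r (Suc (Suc n)) - ?r (Suc n)"
  proof -
    have "(1/2) * ((s + r) * (s - r)) = (1 + s * s) / 2 - s" if "2 * s = 1 + r * r" for r s :: real
      using that by (simp add: field_simps)
    from this[of "?r (Suc n)" "?r n"] show ?thesis
      by (simp only: sqrt_majorant.simps(2)) simp
  qed
  finally show ?case .
qed

text \<open>
  The differences of the iterates are dominated by a convergent telescoping series. The limit
  inherits from the iterates that it commutes with everything that commutes with \<open>x\<close>, which is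
  the only form of functional calculus used below.
\<close>

lemma square_root_one_minus:
  fixes x :: "'a::unital_cstar_algebra"
  assumes x: "norm x \<le> 1"
  obtains y where "norm y \<le> 1" "(1 - y) * (1 - y) = 1 - x"
    "\<And>z. z * x = x * z \<Longrightarrow> z * y = y * z" "star x = x \<Longrightarrow> star y = y"
proof -
  let ?y = "sqrt_iterate x" and ?r = sqrt_majorant
  have "convergent ?r"
    by (rule Bseq_monoseq_convergent, rule BseqI'[of _ 1])
      (use sqrt_majorant_bounds in \<open>auto intro: mono_SucI1 sqrt_majorant_Suc\<close>)
  then have "summable (\<lambda>n. ?r (Suc n) - ?r n)"
    using telescope_summable unfolding convergent_def by blast
  then have "summable (\<lambda>n. ?y (Suc n) - ?y n)"
    by (rule summable_comparison_test'[where N = 0]) (use norm_sqrt_iterate_Suc_diff[OF x] in auto)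
  then have "convergent (\<lambda>n. \<Sum>i<n. ?y (Suc i) - ?y i)"
    by (simp add: summable_iff_convergent)
  then have "convergent ?y"
    by (simp only: sum_lessThan_telescope) simp
  then obtain y where y: "?y \<longlonglongrightarrow> y" by (auto simp: convergent_def)
  have "(\<lambda>n. ?y (Suc n)) \<longlonglongrightarrow> (1/2) *\<^sub>R (x + y * y)"
    unfolding sqrt_iterate.simps by (intro tendsto_intros y)
  then have fixpoint: "y = (1/2) *\<^sub>R (x + y * y)"
    using LIMSEQ_Suc[OF y] LIMSEQ_unique by blast
  have "2 *\<^sub>R y = x + y * y"
    using arg_cong[OF fixpoint, of "scaleR 2"] by (simp only: scaleR_scaleR) simp
  then have "x = y + y - y * y" by (simp add: scaleR_2 eq_diff_eq)
  then have "(1 - y) * (1 - y) = 1 - x"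
    by (simp add: algebra_simps)
  moreover have "norm y \<le> 1"
    by (rule LIMSEQ_le_const2[OF tendsto_norm[OF y]])
      (meson norm_sqrt_iterate[OF x] sqrt_majorant_bounds order_trans)
  moreover have "z * y = y * z" if "z * x = x * z" for z
    by (rule LIMSEQ_unique[OF tendsto_mult_left[OF y]])
      (use tendsto_mult_right[OF y, of z] sqrt_iterate_commute[OF that] in simp)
  moreover have "star y = y" if "star x = x"
    by (rule LIMSEQ_unique[OF tendsto_star[OF y]]) (simp add: sqrt_iterate_star[OF that] y)
  ultimately show thesis using that by blast
qed

text \<open>
  Squares of self-adjoint elements are the positive elements that the square root lemma can
  handle. They coincide with the elements \<open>b\<^sup>* b\<close>, but this is the deepest fact of the section
  (\<open>positive_element_iff_sa_square\<close>).
\<close>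

definition sa_square :: "'a::unital_cstar_algebra \<Rightarrow> bool" where
  "sa_square a \<longleftrightarrow> (\<exists>c. star c = c \<and> a = c * c)"

lemma sa_square_star: "sa_square a \<Longrightarrow> star a = a"
  by (auto simp: sa_square_def star_mult)

lemma sa_square_positive: "sa_square a \<Longrightarrow> positive_element a"
  by (metis positive_element_def sa_square_def)

lemma norm_le_one_of_isometry: "star u * u = 1 \<Longrightarrow> norm (u::'a::unital_cstar_algebra) \<le> 1"
  using cstar_identity[of u] norm_one_le[where 'a='a] 
  by (metis norm_ge_zero power_le_one_iff zero_neq_numeral)

text \<open>
  For commuting self-adjoint \<open>c\<close> and \<open>d\<close> the element \<open>u = c + i d\<close> is normal. Computing
  \<open>\<parallel>u\<parallel>\<close> from \<open>u\<^sup>* u = c\<^sup>2 + d\<^sup>2\<close> bounds \<open>c\<close> and \<open>d\<close>; this replaces spectral arguments.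
\<close>

lemma norm_complex_parts:
  fixes c d :: "'a::unital_cstar_algebra"
  assumes "star c = c" "star d = d" "c * d = d * c"
  defines "u \<equiv> c + \<i> *\<^sub>C d"
  shows "star u * u = c * c + d * d" "norm c \<le> norm u" "norm d \<le> norm u"
proof -
  have su: "star u = c - \<i> *\<^sub>C d"
    using assms by (simp add: star_add star_scaleC scaleC_minus_left)
  show "star u * u = c * c + d * d"
    unfolding su unfolding u_def
    by (simp add: algebra_simps mult_scaleC_left mult_scaleC_right scaleC_scaleC
        scaleC_minus_left scaleC_one_left scaleC_add_right scaleC_diff_right assms)
  have "norm (u + star u) \<le> 2 * norm u" "norm (u - star u) \<le> 2 * norm u"
    using norm_triangle_ineq[of u "star u"] norm_triangle_ineq4[of u "star u"]
    by (simp_all add: norm_star)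
  moreover have "u + star u = 2 *\<^sub>R c" "u - star u = \<i> *\<^sub>C (2 *\<^sub>R d)"
    unfolding su unfolding u_def by (simp_all add: scaleR_2 scaleC_add_right)
  ultimately show "norm c \<le> norm u" "norm d \<le> norm u"
    by (simp_all add: norm_scaleC)
qed

text \<open>
  With \<open>d = \<surd>(1 - c\<^sup>2)\<close> the element \<open>c + i d\<close> is unitary, so \<open>\<parallel>d\<parallel> \<le> 1\<close> and \<open>1 - c\<^sup>2 = d\<^sup>2\<close>.
\<close>

lemma norm_one_minus_square_le:
  fixes c :: "'a::unital_cstar_algebra"
  assumes c: "star c = c" and n: "norm c \<le> 1"
  shows "norm (1 - c * c) \<le> 1"
proof -
  have "norm (c * c) \<le> 1"
    using n norm_mult_ineq[of c c] mult_le_one[of "norm c" "norm c"] by auto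
  then obtain y where y: "(1 - y) * (1 - y) = 1 - c * c"
      "\<And>z. z * (c * c) = c * c * z \<Longrightarrow> z * y = y * z" "star (c * c) = c * c \<Longrightarrow> star y = y"
    using square_root_one_minus by blast
  define d where "d = 1 - y"
  have d: "star d = d" "c * d = d * c"
    using y(2)[of c] y(3) c by (auto simp: d_def star_diff star_mult algebra_simps)
  let ?u = "c + \<i> *\<^sub>C d"
  have "star ?u * ?u = 1"
    using norm_complex_parts(1)[OF c d] y(1) by (simp add: d_def)
  then have "norm d \<le> 1"
    using norm_complex_parts(3)[OF c d] norm_le_one_of_isometry order_trans by blast
  then have "norm (d * d) \<le> 1"
    using norm_mult_ineq[of d d] mult_le_one[of "norm d" "norm d"] by auto
  then show ?thesis by (simp add: y(1) d_def)
qed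

text \<open>
  Together with the converse \<open>sa_squareI\<close> this describes the cone by the norm inequalities
  \<open>\<parallel>t - a\<parallel> \<le> t\<close>. Those are visibly stable under sums and limits.
\<close>

lemma sa_square_norm_diff:
  fixes a :: "'a::unital_cstar_algebra"
  assumes "sa_square a" and t: "norm a \<le> t"
  shows "norm (t *\<^sub>R 1 - a) \<le> t"
proof (cases "t = 0")
  case True
  then show ?thesis using t by simp
next
  case False
  then have tpos: "0 < t" using t norm_ge_zero[of a] by linarith
  obtain c where c: "star c = c" "a = c * c" using assms by (auto simp: sa_square_def)
  let ?d = "(1 / sqrt t) *\<^sub>R c"
  have "(norm c)\<^sup>2 \<le> t"
    using cstar_identity[of c] c t by simp
  then have "norm ?d \<le> 1"
    using tpos real_le_rsqrt by (auto simp: divide_simps)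
  then have "norm (1 - ?d * ?d) \<le> 1"
    by (intro norm_one_minus_square_le) (auto simp: star_scaleR c)
  moreover have "1 - ?d * ?d = (1 / t) *\<^sub>R (t *\<^sub>R 1 - a)"
    using tpos c by (simp add: algebra_simps)
  ultimately show ?thesis using tpos by (simp add: divide_simps)
qed

text \<open>
  Rescale so that \<open>a = t (1 - x)\<close> with \<open>\<parallel>x\<parallel> \<le> 1\<close>. The root found for \<open>1 - x\<close> lies within
  distance \<open>1\<close> of \<open>1\<close>, hence it satisfies the same kind of inequality as \<open>a\<close> and is itself positive.
\<close>

lemma square_root_in_cone:
  fixes a :: "'a::unital_cstar_algebra"
  assumes a: "star a = a" and t: "norm (t *\<^sub>R 1 - a) \<le> t"
  obtains c where "star c = c" "c * c = a" "\<And>z. z * a = a * z \<Longrightarrow> z * c = c * z"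
    "norm (sqrt t *\<^sub>R 1 - c) \<le> sqrt t"
proof (cases "t = 0")
  case True
  then have "a = 0" using t by simp
  with that[of 0] True show ?thesis by simp
next
  case False
  then have tpos: "0 < t" using t norm_ge_zero[of "t *\<^sub>R 1 - a"] by linarith
  let ?x = "(1 / t) *\<^sub>R (t *\<^sub>R 1 - a)"
  have "norm ?x \<le> 1" using t tpos by simp
  then obtain y where y: "norm y \<le> 1" "(1 - y) * (1 - y) = 1 - ?x"
    "\<And>z. z * ?x = ?x * z \<Longrightarrow> z * y = y * z" "star ?x = ?x \<Longrightarrow> star y = y"
    using square_root_one_minus by blast
  have ax: "a = t *\<^sub>R (1 - ?x)" using tpos by (simp add: algebra_simps)
  let ?c = "sqrt t *\<^sub>R (1 - y)"
  show ?thesis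
  proof (rule that[of ?c])
    show "star ?c = ?c" using y(4) a by (simp add: star_scaleR star_diff)
    have "?c * ?c = t *\<^sub>R ((1 - y) * (1 - y))" using tpos by simp
    then show "?c * ?c = a" using y(2) ax by metis
    show "z * ?c = ?c * z" if "z * a = a * z" for z
      using y(3)[of z] that by (simp add: algebra_simps)
    have "sqrt t *\<^sub>R 1 - ?c = sqrt t *\<^sub>R y" by (simp add: algebra_simps)
    then show "norm (sqrt t *\<^sub>R 1 - ?c) \<le> sqrt t"
      using y(1) tpos by (simp add: mult_left_le)
  qed
qed

lemma sa_squareI: "star a = a \<Longrightarrow> norm (t *\<^sub>R 1 - a) \<le> t \<Longrightarrow> sa_square a"
  using square_root_in_cone sa_square_def by metis

lemma sa_square_root:
  assumes "sa_square a"
  obtains c where "sa_square c" "c * c = a" "\<And>z. z * a = a * z \<Longrightarrow> z * c = c * z"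
proof -
  obtain c where "star c = c" "c * c = a" "\<And>z. z * a = a * z \<Longrightarrow> z * c = c * z"
     "norm (sqrt (norm a) *\<^sub>R 1 - c) \<le> sqrt (norm a)"
    using square_root_in_cone[OF sa_square_star sa_square_norm_diff, OF assms assms order_refl]
    by metis
  then show thesis using that sa_squareI by blast
qed

lemma sa_square_add:
  assumes "sa_square a" "sa_square b"
  shows "sa_square (a + b)"
proof (rule sa_squareI)
  show "star (a + b) = a + b" by (simp add: star_add sa_square_star assms)
  have "(norm a + norm b) *\<^sub>R 1 - (a + b) = (norm a *\<^sub>R 1 - a) + (norm b *\<^sub>R 1 - b)"
    by (simp add: algebra_simps)
  then show "norm ((norm a + norm b) *\<^sub>R 1 - (a + b)) \<le> norm a + norm b"
    by (metis norm_triangle_le add_mono sa_square_norm_diff assms order_refl)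
qed

lemma sa_square_sa_mult: "star c = c \<Longrightarrow> sa_square (c * c)"
  by (auto simp: sa_square_def)

lemma sa_square_scaleR: "sa_square a \<Longrightarrow> 0 \<le> t \<Longrightarrow> sa_square (t *\<^sub>R a)"
proof -
  assume "sa_square a" "0 \<le> t"
  then obtain c where "star c = c" "a = c * c" by (auto simp: sa_square_def)
  then show ?thesis using sa_square_sa_mult[of "sqrt t *\<^sub>R c"] \<open>0 \<le> t\<close> by (simp add: star_scaleR)
qed

text \<open>
  If \<open>a = c\<^sup>2\<close> and \<open>- a = d\<^sup>2\<close> with commuting roots, then \<open>u = c + i d\<close> has \<open>u\<^sup>* u = 0\<close>.
\<close>

lemma sa_square_antisym:
  fixes a :: "'a::unital_cstar_algebra"
  assumes "sa_square a" "sa_square (- a)"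
  shows "a = 0"
proof -
  obtain c where c: "sa_square c" "c * c = a" "\<And>z. z * a = a * z \<Longrightarrow> z * c = c * z"
    using sa_square_root[OF assms(1)] by blast
  obtain d where d: "sa_square d" "d * d = - a" "\<And>z. z * (- a) = - a * z \<Longrightarrow> z * d = d * z"
    using sa_square_root[OF assms(2)] by blast
  have "c * (- a) = - a * c" using c(2) by (auto simp: mult.assoc)
  then have cd: "c * d = d * c" by (rule d(3))
  note parts = norm_complex_parts[OF c(1)[THEN sa_square_star] d(1)[THEN sa_square_star] cd]
  have "c + \<i> *\<^sub>C d = 0"
    using parts(1) c(2) d(2) by - (rule star_mult_self_eq_zero, simp)
  then have "c = 0" using parts(2) by simp
  then show ?thesis using c(2) by simp
qed

text \<open>
  If \<open>a = c\<^sup>2\<close> and \<open>t - a = d\<^sup>2\<close> with commuting roots, then \<open>u = c + i d\<close> has \<open>u\<^sup>* u = t\<close>,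
  so \<open>\<parallel>a\<parallel> = \<parallel>c\<parallel>\<^sup>2 \<le> \<parallel>u\<parallel>\<^sup>2 \<le> t\<close>.
\<close>

lemma norm_le_of_sa_square_diff:
  fixes a :: "'a::unital_cstar_algebra"
  assumes "sa_square a" "sa_square (t *\<^sub>R 1 - a)" "0 \<le> t"
  shows "norm a \<le> t"
proof -
  obtain c where c: "sa_square c" "c * c = a" "\<And>z. z * a = a * z \<Longrightarrow> z * c = c * z"
    using sa_square_root[OF assms(1)] by blast
  let ?b = "t *\<^sub>R 1 - a"
  obtain d where d: "sa_square d" "d * d = ?b" "\<And>z. z * ?b = ?b * z \<Longrightarrow> z * d = d * z"
    using sa_square_root[OF assms(2)] by blast
  have "c * ?b = ?b * c" using c(2) by (auto simp: algebra_simps)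
  then have cd: "c * d = d * c" by (rule d(3))
  let ?u = "c + \<i> *\<^sub>C d"
  note parts = norm_complex_parts[OF c(1)[THEN sa_square_star] d(1)[THEN sa_square_star] cd]
  have "star ?u * ?u = t *\<^sub>R 1"
    using parts(1) c(2) d(2) by simp
  then have "(norm ?u)\<^sup>2 \<le> t"
    using cstar_identity[of ?u] assms(3) mult_left_le[OF norm_one_le[where 'a='a] assms(3)] by simp
  moreover have "norm a = (norm c)\<^sup>2"
    using cstar_identity[of c] c(1)[THEN sa_square_star] c(2) by simp
  moreover have "(norm c)\<^sup>2 \<le> (norm ?u)\<^sup>2"
    using parts(2) by (intro power_mono) auto
  ultimately show ?thesis by linarith
qed

text \<open>
  The core of Kaplansky's argument. For \<open>h = - c\<^sup>* c \<ge> 0\<close> and \<open>d = c \<surd>h\<close> both \<open>d\<^sup>* d\<close> and \<open>d d\<^sup>*\<close> are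
  negatives of squares, while their sum is positive, being half the sum of the squares of the
  self-adjoint elements \<open>d + d\<^sup>*\<close> and \<open>i (d - d\<^sup>*)\<close>. Hence everything vanishes.
\<close>

lemma star_mult_self_negative_eq_zero:
  fixes c :: "'a::unital_cstar_algebra"
  assumes "sa_square (- (star c * c))"
  shows "c = 0"
proof -
  let ?h = "- (star c * c)" and ?k = "c * star c"
  obtain r where r: "sa_square r" "r * r = ?h" "\<And>z. z * ?h = ?h * z \<Longrightarrow> z * r = r * z"
    using sa_square_root[OF assms] by blast
  note sr = sa_square_star[OF r(1)]
  define d where "d = c * r"
  have "star d * d = - (r * ?h * r)"
    by (simp add: d_def star_mult sr mult.assoc)
  also have "r * ?h * r = ?h * ?h" by (metis r(2) mult.assoc)
  finally have dd: "star d * d = - (?h * ?h)" .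
  have "d * star d = c * (r * r) * star c" by (simp add: d_def star_mult sr mult.assoc)
  then have dd': "d * star d = - (?k * ?k)" unfolding r(2) by (simp add: mult.assoc)
  define x where "x = d + star d"
  define y where "y = \<i> *\<^sub>C (d - star d)"
  have sx: "star x = x" by (simp add: x_def star_add star_star add.commute)
  have sy: "star y = y"
    by (simp add: y_def star_scaleC star_diff star_star scaleC_minus_left
        scaleC_minus_right[symmetric])
  have xy: "x * x + y * y = 2 *\<^sub>R (star d * d + d * star d)"
    unfolding x_def y_def mult_scaleC_left mult_scaleC_right scaleC_scaleC
    by (simp add: scaleC_minus_left scaleC_one_left algebra_simps scaleR_2)
  then have sum0: "- (?h * ?h) = ?k * ?k + (1/2) *\<^sub>R (x * x + y * y)"
    unfolding xy dd dd' by simp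
  have "sa_square (- (?h * ?h))"
    unfolding sum0 using sx sy
    by (intro sa_square_add sa_square_scaleR sa_square_sa_mult) (simp_all add: star_mult star_star)
  moreover have sh: "star ?h = ?h" by (simp add: star_minus star_mult star_star)
  ultimately have "?h * ?h = 0"
    by (intro sa_square_antisym sa_square_sa_mult)
  then have "?h = 0" by (rule selfadjoint_square_eq_zero[OF sh])
  then show ?thesis by - (rule star_mult_self_eq_zero, simp)
qed

text \<open>
  Let \<open>a = b\<^sup>* b\<close>, let \<open>m = \<bar>a\<bar>\<close> be the root of \<open>a\<^sup>2\<close> and \<open>n = m - a\<close> twice the negative part of \<open>a\<close>.
  Then \<open>(b n)\<^sup>* (b n) = n a n\<close> is the negative of a square, so \<open>b n = 0\<close>, which forces \<open>n = 0\<close>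
  and \<open>a = m\<close>.
\<close>

theorem positive_element_iff_sa_square:
  "positive_element a \<longleftrightarrow> sa_square (a::'a::unital_cstar_algebra)"
proof
  assume "positive_element a"
  then obtain b where b: "a = star b * b" by (auto simp: positive_element_def)
  then have sa: "star a = a" by (simp add: star_mult star_star)
  obtain m where m: "sa_square m" "m * m = a * a" "\<And>z. z * (a * a) = a * a * z \<Longrightarrow> z * m = m * z"
    using sa_square_root[OF sa_square_sa_mult[OF sa]] by blast
  obtain r where r: "sa_square r" "r * r = m" "\<And>z. z * m = m * z \<Longrightarrow> z * r = r * z"
    using sa_square_root[OF m(1)] by blast
  have am: "a * m = m * a" by (rule m(3)) (simp add: mult.assoc)
  define n where "n = m - a"
  have sn: "star n = n" by (simp add: n_def star_diff sa sa_square_star[OF m(1)])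
  have nm: "n * m = m * n" by (simp add: n_def algebra_simps am)
  have nr: "n * r = r * n" by (rule r(3)[OF nm])
  have na: "n * a = - (m * n)"
    using m(2) by (simp add: n_def algebra_simps am)
  \<comment> \<open>As \<open>n a = - m n\<close> and \<open>m = r\<^sup>2\<close>, this product is \<open>- (r n)\<^sup>2\<close>.\<close>
  have "star (b * n) * (b * n) = n * a * n"
    by (simp add: star_mult sn b mult.assoc)
  also have "\<dots> = - (r * n * (r * n))"
    unfolding na r(2)[symmetric] by (metis mult.assoc minus_mult_left nr)
  finally have bn: "- (star (b * n) * (b * n)) = r * n * (r * n)" by simp
  have "star (r * n) = r * n" by (simp add: star_mult sn sa_square_star[OF r(1)] nr)
  then have "b * n = 0"
    by - (rule star_mult_self_negative_eq_zero, simp add: bn sa_square_sa_mult)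
  then have an: "a * n = 0" by (simp add: b mult.assoc)
  have an': "n * a = 0" 
    using arg_cong[OF an, of star] by (simp add: star_mult sa sn)
  have "n * n * (n * n) = 0"
  proof -
    have "n * n = n * m - n * a" by (subst (2) n_def) (rule right_diff_distrib)
    then have "n * n = n * m" using an' by simp
    also have "\<dots> = 0" using na an' nm by simp
    finally show ?thesis by simp
  qed
  then have "n * n = 0" by (rule selfadjoint_square_eq_zero[rotated]) (simp_all add: star_mult sn)
  then have "n = 0" by (rule selfadjoint_square_eq_zero[OF sn])
  then show "sa_square a" using m(1) by (simp add: n_def)
qed (rule sa_square_positive)

lemma positive_star_mult: "positive_element (star b * b)"
  by (auto simp: positive_element_def)

lemma positive_zero: "positive_element (0::'a::unital_cstar_algebra)"
  using positive_star_mult[of "0::'a"] by simp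

lemma positive_add: "positive_element a \<Longrightarrow> positive_element b \<Longrightarrow> positive_element (a + b)"
  by (simp add: positive_element_iff_sa_square sa_square_add)

lemma positive_sum: "(\<And>i. i \<in> I \<Longrightarrow> positive_element (f i)) \<Longrightarrow> positive_element (sum f I)"
  by (induction I rule: infinite_finite_induct) (simp_all add: positive_zero positive_add)

lemma positive_selfadjoint: "positive_element a \<Longrightarrow> star a = a"
  by (auto simp: positive_element_def star_mult star_star)

lemma positive_conj: "positive_element a \<Longrightarrow> positive_element (star b * a * b)"
  by (metis positive_element_def star_mult mult.assoc)

lemma positive_norm_diff: "positive_element a \<Longrightarrow> positive_element (norm a *\<^sub>R 1 - a)"
  unfolding positive_element_iff_sa_square
  by (rule sa_squareI[where t = "norm a"]) (auto simp: star_diff star_scaleR sa_square_star)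

text \<open>
  Since \<open>b \<le> \<parallel>b\<parallel>\<close>, also \<open>a \<le> \<parallel>b\<parallel>\<close>, and an upper bound by a scalar bounds the norm.
\<close>

lemma positive_norm_mono:
  assumes "positive_element a" "positive_element (b - a)"
  shows "norm a \<le> norm b"
proof (rule norm_le_of_sa_square_diff)
  have "positive_element b" using positive_add[OF assms] by simp
  then have "positive_element ((norm b *\<^sub>R 1 - b) + (b - a))"
    by (intro positive_add positive_norm_diff assms)
  then show "sa_square (norm b *\<^sub>R 1 - a)" by (simp add: positive_element_iff_sa_square)
qed (use assms positive_element_iff_sa_square in auto)

text \<open>
  The inequality \<open>\<parallel>t - a\<parallel> \<le> t\<close> holds with \<open>t = \<parallel>a\<parallel>\<close>, and both sides are continuous in \<open>a\<close>.
\<close>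

lemma positive_limit:
  fixes a :: "nat \<Rightarrow> 'a::unital_cstar_algebra"
  assumes pos: "\<And>n. positive_element (a n)" and lim: "a \<longlonglongrightarrow> l"
  shows "positive_element l"
  unfolding positive_element_iff_sa_square
proof (rule sa_squareI)
  show "star l = l"
    using LIMSEQ_unique[OF tendsto_star[OF lim]] lim by (simp add: positive_selfadjoint pos)
  have le: "norm (norm (a n) *\<^sub>R 1 - a n) \<le> norm (a n)" for n
    using pos[of n] by (intro sa_square_norm_diff) (auto simp: positive_element_iff_sa_square)
  have "(\<lambda>n. norm (norm (a n) *\<^sub>R 1 - a n)) \<longlonglongrightarrow> norm (norm l *\<^sub>R 1 - l)"
    by (intro tendsto_intros lim)
  then show "norm (norm l *\<^sub>R 1 - l) \<le> norm l"
    by (rule LIMSEQ_le[OF _ tendsto_norm[OF lim]]) (use le in blast)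
qed

section \<open>*-automorphisms are isometric\<close>

lemma star_automorphism_simps:
  assumes "star_automorphism \<phi>"
  shows "\<phi> (a * b) = \<phi> a * \<phi> b" "\<phi> 1 = 1" "\<phi> (star a) = star (\<phi> a)"
    "\<phi> (a + b) = \<phi> a + \<phi> b" "\<phi> (c *\<^sub>C a) = c *\<^sub>C \<phi> a" "\<phi> 0 = 0" "\<phi> (a - b) = \<phi> a - \<phi> b"
    "\<phi> (r *\<^sub>R a) = r *\<^sub>R \<phi> a" "\<phi> (- a) = - \<phi> a"
  using assms
  by (auto simp: star_automorphism_def Vector_Spaces.linear_iff_module_hom module_hom.add
      module_hom.scale module_hom.diff module_hom.zero module_hom.neg scaleR_scaleC)

text \<open>
  A unital *-homomorphism preserves the relation \<open>a\<^sup>* a \<le> \<parallel>a\<parallel>\<^sup>2\<close>.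
\<close>

lemma star_automorphism_norm_le:
  assumes "star_automorphism \<phi>"
  shows "norm (\<phi> a) \<le> norm a"
proof -
  note [simp] = star_automorphism_simps[OF assms]
  have "positive_element (norm (star a * a) *\<^sub>R 1 - star a * a)"
    by (rule positive_norm_diff[OF positive_star_mult])
  then obtain c where "norm (star a * a) *\<^sub>R 1 - star a * a = star c * c"
    by (auto simp: positive_element_def)
  from arg_cong[OF this, of \<phi>]
  have "positive_element (norm (star a * a) *\<^sub>R 1 - star (\<phi> a) * \<phi> a)"
    by (simp add: positive_star_mult)
  then have "norm (star (\<phi> a) * \<phi> a) \<le> norm (norm (star a * a) *\<^sub>R (1::'a))"
    by (rule positive_norm_mono[OF positive_star_mult])
  also have "\<dots> \<le> norm (star a * a)"
    using norm_one_le[where 'a='a] by (simp add: mult_left_le)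
  finally show ?thesis
    by (simp add: cstar_identity)
qed

lemma star_automorphism_bounded_linear:
  assumes "star_automorphism \<phi>"
  shows "bounded_linear \<phi>"
  by (rule bounded_linear_intro[of _ 1])
    (simp_all add: star_automorphism_simps[OF assms] star_automorphism_norm_le[OF assms])

lemma star_automorphism_inv:
  assumes "star_automorphism \<phi>"
  shows "star_automorphism (inv \<phi>)"
proof -
  note S = star_automorphism_simps[OF assms]
  have bij: "bij \<phi>" using assms by (simp add: star_automorphism_def)
  have f: "\<phi> (inv \<phi> a) = a" for a using bij by (simp add: bij_is_surj surj_f_inv_f)
  have eq: "inv \<phi> a = b" if "a = \<phi> b" for a b using bij that by (simp add: bij_is_inj)
  have mod: "module (scaleC :: complex \<Rightarrow> 'a \<Rightarrow> 'a)"
    using vector_space_scaleC by (simp add: module_iff_vector_space)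
  have "module_hom (scaleC :: complex \<Rightarrow> 'a \<Rightarrow> 'a) scaleC (inv \<phi>)"
    by (intro module_hom.intro module_hom_axioms.intro mod) (auto intro!: eq simp: S f)
  then show ?thesis
    using bij by (auto simp: star_automorphism_def Vector_Spaces.linear_iff_module_hom S f bij_imp_bij_inv intro!: eq)
qed

lemma star_automorphism_norm:
  assumes "star_automorphism \<phi>"
  shows "norm (\<phi> a) = norm a"
proof (rule antisym)
  have "inj \<phi>" using assms by (simp add: star_automorphism_def bij_is_inj)
  then show "norm a \<le> norm (\<phi> a)"
    using star_automorphism_norm_le[OF star_automorphism_inv[OF assms], of "\<phi> a"] by simp
qed (rule star_automorphism_norm_le[OF assms])

section \<open>Inner product modules\<close>

text \<open>
  Inner product modules whose inner product may be degenerate. Complex scalars act through \<open>c 1\<close>,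
  and the laws for the left variable of the inner product follow from the Hermitian symmetry. The same results then serve the span of a
  kernel, its completion, and abstract Hilbert modules.
\<close>

locale pre_hilbert_module =
  fixes X :: "('x::ab_group_add, 'a::unital_cstar_algebra) hmod"
  assumes zero_mem: "0 \<in> hcarrier X"
    and add_mem: "x \<in> hcarrier X \<Longrightarrow> y \<in> hcarrier X \<Longrightarrow> x + y \<in> hcarrier X"
    and act_mem: "x \<in> hcarrier X \<Longrightarrow> hact X x a \<in> hcarrier X"
    and act_add: "x \<in> hcarrier X \<Longrightarrow> hact X x (a + b) = hact X x a + hact X x b"
    and act_unit: "x \<in> hcarrier X \<Longrightarrow> hact X x 1 = x"
    and inner_add: "x \<in> hcarrier X \<Longrightarrow> y \<in> hcarrier X \<Longrightarrow> z \<in> hcarrier X \<Longrightarrow>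
      hip X x (y + z) = hip X x y + hip X x z"
    and inner_act: "x \<in> hcarrier X \<Longrightarrow> y \<in> hcarrier X \<Longrightarrow> hip X x (hact X y a) = hip X x y * a"
    and inner_star: "x \<in> hcarrier X \<Longrightarrow> y \<in> hcarrier X \<Longrightarrow> star (hip X x y) = hip X y x"
    and inner_positive: "x \<in> hcarrier X \<Longrightarrow> positive_element (hip X x x)"

sublocale hilbert_module \<subseteq> pre_hilbert_module
  by unfold_locales
    (simp_all add: zero_closed add_closed act_closed act_add_right act_one ip_add ip_act
      ip_star[symmetric] ip_positive)

definition hcauchy :: "('x::ab_group_add, 'a::unital_cstar_algebra) hmod \<Rightarrow> (nat \<Rightarrow> 'x) \<Rightarrow> bool" where
  "hcauchy X s \<longleftrightarrow> (\<forall>\<epsilon>>0. \<exists>N. \<forall>m\<ge>N. \<forall>n\<ge>N. hnorm X (s m - s n) < \<epsilon>)"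

definition hconverges ::
  "('x::ab_group_add, 'a::unital_cstar_algebra) hmod \<Rightarrow> (nat \<Rightarrow> 'x) \<Rightarrow> 'x \<Rightarrow> bool" where
  "hconverges X s x \<longleftrightarrow> (\<lambda>n. hnorm X (s n - x)) \<longlonglongrightarrow> 0"

text \<open>
  Lists as index sets make the sum of two combinations an appended list.
\<close>

definition combination :: "('x::ab_group_add, 'a) hmod \<Rightarrow> ('i \<Rightarrow> 'x) \<Rightarrow> ('i \<times> 'a) list \<Rightarrow> 'x" where
  "combination X e xs = (\<Sum>(i, b)\<leftarrow>xs. hact X (e i) b)"

lemma combination_simps [simp]:
  "combination X e [] = 0"
  "combination X e (ib # xs) = hact X (e (fst ib)) (snd ib) + combination X e xs"
  "combination X e (xs @ ys) = combination X e xs + combination X e ys"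
  by (simp_all add: combination_def split_beta)

lemma hnorm_nonneg [simp]: "0 \<le> hnorm X x"
  by (simp add: hnorm_def)

lemma hnorm_square: "(hnorm X x)\<^sup>2 = norm (hip X x x)"
  by (simp add: hnorm_def)

lemma hcauchyD: "hcauchy X s \<Longrightarrow> 0 < \<epsilon> \<Longrightarrow> \<exists>N. \<forall>m\<ge>N. \<forall>n\<ge>N. hnorm X (s m - s n) < \<epsilon>"
  by (simp add: hcauchy_def)

context pre_hilbert_module
begin

lemma act_zero: "x \<in> hcarrier X \<Longrightarrow> hact X x 0 = 0"
  using act_add[of x 0 0] by simp

lemma act_neg: "x \<in> hcarrier X \<Longrightarrow> hact X x (- a) = - hact X x a"
  using act_add[of x a "- a"] by (simp add: act_zero eq_neg_iff_add_eq_0 add.commute)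

lemma neg_mem: "x \<in> hcarrier X \<Longrightarrow> - x \<in> hcarrier X"
  using act_mem[of x "- 1"] by (simp add: act_neg act_unit)

lemma diff_mem: "x \<in> hcarrier X \<Longrightarrow> y \<in> hcarrier X \<Longrightarrow> x - y \<in> hcarrier X"
  using add_mem[of x "- y"] by (simp add: neg_mem)

lemma inner_zero: "x \<in> hcarrier X \<Longrightarrow> hip X x 0 = 0"
  using inner_add[of x 0 0] by (simp add: zero_mem)

lemma inner_diff: "x \<in> hcarrier X \<Longrightarrow> y \<in> hcarrier X \<Longrightarrow> z \<in> hcarrier X \<Longrightarrow>
    hip X x (y - z) = hip X x y - hip X x z"
  using inner_add[of x "y - z" z] by (simp add: diff_mem)

lemma inner_add_left: "x \<in> hcarrier X \<Longrightarrow> y \<in> hcarrier X \<Longrightarrow> z \<in> hcarrier X \<Longrightarrow>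
    hip X (x + y) z = hip X x z + hip X y z"
  using inner_add[of z x y] by (metis add_mem inner_star star_add)

lemma inner_diff_left: "x \<in> hcarrier X \<Longrightarrow> y \<in> hcarrier X \<Longrightarrow> z \<in> hcarrier X \<Longrightarrow>
    hip X (x - y) z = hip X x z - hip X y z"
  using inner_add_left[of "x - y" y z] by (simp add: diff_mem)

lemma inner_act_left: "x \<in> hcarrier X \<Longrightarrow> y \<in> hcarrier X \<Longrightarrow>
    hip X (hact X x a) y = star a * hip X x y"
  using inner_act[of y x a] by (metis act_mem inner_star star_mult)

lemma inner_zero_left: "x \<in> hcarrier X \<Longrightarrow> hip X 0 x = 0"
  using inner_star[of x 0] by (simp add: zero_mem inner_zero)

lemmas inner_simps = inner_add inner_add_left inner_diff inner_diff_left inner_act inner_act_left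
  inner_zero inner_zero_left

lemmas mem_simps = zero_mem add_mem diff_mem neg_mem act_mem

text \<open>
  Expanding \<open>\<langle>x a - y, x a - y\<rangle> \<ge> 0\<close> for \<open>a = \<langle>x, y\<rangle> / M\<close> and estimating \<open>\<langle>x, x\<rangle> \<le> M\<close> yields
  \<open>\<langle>x, y\<rangle>\<^sup>* \<langle>x, y\<rangle> \<le> M \<langle>y, y\<rangle>\<close> for every \<open>M > 0\<close> with \<open>\<parallel>\<langle>x, x\<rangle>\<parallel> \<le> M\<close>.
\<close>

lemma cauchy_schwarz:
  assumes x: "x \<in> hcarrier X" and y: "y \<in> hcarrier X"
  shows "norm (hip X x y) \<le> hnorm X x * hnorm X y"
proof -
  let ?w = "star (hip X x y) * hip X x y"
  have sxy: "star (hip X x y) = hip X y x" using x y by (rule inner_star)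
  have bound: "(norm (hip X x y))\<^sup>2 \<le> M * norm (hip X y y)"
    if M: "norm (hip X x x) \<le> M" "0 < M" for M
  proof -
    define a where "a = (1 / M) *\<^sub>R hip X x y"
    \<comment> \<open>Three positive terms whose sum is \<open>\<langle>y, y\<rangle> - w / M\<close>.\<close>
    have "positive_element (star a * (norm (hip X x x) *\<^sub>R 1 - hip X x x) * a)"
      by (intro positive_conj positive_norm_diff inner_positive x)
    moreover have "positive_element (star a * ((M - norm (hip X x x)) *\<^sub>R 1) * a)"
      using positive_star_mult[of "sqrt (M - norm (hip X x x)) *\<^sub>R a"] M by (simp add: star_scaleR)
    moreover have "positive_element (hip X (hact X x a - y) (hact X x a - y))"
      by (intro inner_positive mem_simps x y)
    ultimately have "positive_element (star a * (norm (hip X x x) *\<^sub>R 1 - hip X x x) * a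
       + star a * ((M - norm (hip X x x)) *\<^sub>R 1) * a
       + hip X (hact X x a - y) (hact X x a - y))"
      by (intro positive_add)
    also have "star a * (norm (hip X x x) *\<^sub>R 1 - hip X x x) * a
        + star a * ((M - norm (hip X x x)) *\<^sub>R 1) * a
        + hip X (hact X x a - y) (hact X x a - y) = hip X y y - (1 / M) *\<^sub>R ?w"
    proof -
      have "star a * hip X x y = (1 / M) *\<^sub>R ?w" "hip X y x * a = (1 / M) *\<^sub>R ?w"
        "M *\<^sub>R (star a * a) = (1 / M) *\<^sub>R ?w"
        using M by (simp_all add: a_def star_scaleR sxy)
      then show ?thesis
        using x y by (simp add: inner_simps mem_simps algebra_simps)
    qed
    finally have "norm ((1 / M) *\<^sub>R ?w) \<le> norm (hip X y y)"
    proof (rule positive_norm_mono[rotated])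
      show "positive_element ((1 / M) *\<^sub>R ?w)"
        using positive_star_mult[of "sqrt (1 / M) *\<^sub>R hip X x y"] M by (simp add: star_scaleR)
    qed
    then show ?thesis using M by (simp add: cstar_identity divide_simps mult.commute)
  qed
  have "(norm (hip X x y))\<^sup>2 \<le> norm (hip X x x) * norm (hip X y y)"
  \<comment> \<open>Let \<open>M\<close> decrease to \<open>\<parallel>\<langle>x, x\<rangle>\<parallel>\<close>, which may be zero.\<close>
  proof (cases "hip X y y = 0")
    case True
    then show ?thesis using bound[of "norm (hip X x x) + 1"] norm_ge_zero[of "hip X x x"] by (simp add: add_nonneg_pos)
  next
    case False
    show ?thesis
    proof (rule dense_ge)
      fix t assume "norm (hip X x x) * norm (hip X y y) < t"
      then have lt: "norm (hip X x x) < t / norm (hip X y y)"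
        using False by (simp add: divide_simps)
      then have "0 < t / norm (hip X y y)" using norm_ge_zero[of "hip X x x"] by linarith
      with bound[of "t / norm (hip X y y)"] lt False
      show "(norm (hip X x y))\<^sup>2 \<le> t" by simp
    qed
  qed
  then have "(norm (hip X x y))\<^sup>2 \<le> (hnorm X x * hnorm X y)\<^sup>2"
    by (simp add: power_mult_distrib hnorm_square)
  then show ?thesis by (rule power2_le_imp_le) simp
qed

lemma hnorm_triangle:
  assumes "x \<in> hcarrier X" "y \<in> hcarrier X"
  shows "hnorm X (x + y) \<le> hnorm X x + hnorm X y"
proof (rule power2_le_imp_le)
  have "hip X (x + y) (x + y) = hip X x x + hip X y x + hip X x y + hip X y y"
    using assms by (simp add: inner_simps mem_simps algebra_simps)
  then have "norm (hip X (x + y) (x + y)) \<le> norm (hip X x x) + norm (hip X y x)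
      + norm (hip X x y) + norm (hip X y y)"
    by (simp add: norm_triangle_le norm_triangle_mono)
  also have "\<dots> \<le> (hnorm X x)\<^sup>2 + hnorm X y * hnorm X x + hnorm X x * hnorm X y + (hnorm X y)\<^sup>2"
    using assms by (intro add_mono cauchy_schwarz) (auto simp: hnorm_square)
  finally show "(hnorm X (x + y))\<^sup>2 \<le> (hnorm X x + hnorm X y)\<^sup>2"
    by (simp add: hnorm_square power2_sum algebra_simps)
qed simp

lemma hnorm_diff_commute: "x \<in> hcarrier X \<Longrightarrow> y \<in> hcarrier X \<Longrightarrow> hnorm X (x - y) = hnorm X (y - x)"
  by (simp add: hnorm_def inner_simps mem_simps algebra_simps)

lemma hnorm_diff_triangle:
  "x \<in> hcarrier X \<Longrightarrow> y \<in> hcarrier X \<Longrightarrow> z \<in> hcarrier X \<Longrightarrow>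
    hnorm X (x - z) \<le> hnorm X (x - y) + hnorm X (y - z)"
  using hnorm_triangle[of "x - y" "y - z"] by (simp add: diff_mem)

lemma hnorm_le_add_diff:
  "x \<in> hcarrier X \<Longrightarrow> y \<in> hcarrier X \<Longrightarrow> hnorm X x \<le> hnorm X y + hnorm X (x - y)"
  using hnorm_triangle[of y "x - y"] by (simp add: diff_mem)

lemma norm_inner_diff_le:
  assumes "x \<in> hcarrier X" "y \<in> hcarrier X" "x' \<in> hcarrier X" "y' \<in> hcarrier X"
  shows "norm (hip X x y - hip X x' y')
    \<le> hnorm X (x - x') * hnorm X y + hnorm X x' * hnorm X (y - y')"
proof -
  have "hip X x y - hip X x' y' = hip X (x - x') y + hip X x' (y - y')"
    using assms by (simp add: inner_simps)
  then show ?thesis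
    using assms by (simp add: norm_triangle_le add_mono cauchy_schwarz diff_mem)
qed

lemma hcauchy_bounded:
  assumes "hcauchy X s" "\<And>n. s n \<in> hcarrier X"
  obtains C N where "0 < C" "\<And>n. N \<le> n \<Longrightarrow> hnorm X (s n) \<le> C"
proof -
  obtain N where N: "\<forall>m\<ge>N. \<forall>n\<ge>N. hnorm X (s m - s n) < 1"
    using hcauchyD[OF assms(1), of 1] by auto
  have "hnorm X (s n) \<le> hnorm X (s N) + 1" if "N \<le> n" for n
    using hnorm_le_add_diff[of "s n" "s N"] assms(2) N that by (smt (verit) order_refl)
  then show thesis using that[of "hnorm X (s N) + 1" N] by (simp add: add_nonneg_pos)
qed

lemma convergent_inner:
  assumes s: "hcauchy X s" "\<And>n. s n \<in> hcarrier X" and t: "hcauchy X t" "\<And>n. t n \<in> hcarrier X"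
  shows "convergent (\<lambda>n. hip X (s n) (t n))"
proof (rule Cauchy_convergent, rule CauchyI)
  fix \<epsilon> :: real assume \<epsilon>: "0 < \<epsilon>"
  obtain C M where C: "0 < C" "\<And>n. M \<le> n \<Longrightarrow> hnorm X (s n) \<le> C"
    using hcauchy_bounded[OF s] by blast
  obtain D K where D: "0 < D" "\<And>n. K \<le> n \<Longrightarrow> hnorm X (t n) \<le> D"
    using hcauchy_bounded[OF t] by blast
  define \<delta> where "\<delta> = \<epsilon> / (C + D)"
  have \<delta>: "0 < \<delta>" "\<delta> * D + C * \<delta> = \<epsilon>"
  proof -
    show "0 < \<delta>" using \<epsilon> C(1) D(1) by (simp add: \<delta>_def)
    have "\<delta> * D + C * \<delta> = (C + D) * \<delta>" by (simp add: algebra_simps)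
    then show "\<delta> * D + C * \<delta> = \<epsilon>" using C(1) D(1) by (simp add: \<delta>_def)
  qed
  obtain N1 where N1: "\<forall>m\<ge>N1. \<forall>n\<ge>N1. hnorm X (s m - s n) < \<delta>"
    using hcauchyD[OF s(1) \<delta>(1)] by auto
  obtain N2 where N2: "\<forall>m\<ge>N2. \<forall>n\<ge>N2. hnorm X (t m - t n) < \<delta>"
    using hcauchyD[OF t(1) \<delta>(1)] by auto
  have "norm (hip X (s m) (t m) - hip X (s n) (t n)) < \<epsilon>"
    if "max (max M K) (max N1 N2) \<le> m" "max (max M K) (max N1 N2) \<le> n" for m n
  proof -
    have "norm (hip X (s m) (t m) - hip X (s n) (t n))
        \<le> hnorm X (s m - s n) * hnorm X (t m) + hnorm X (s n) * hnorm X (t m - t n)"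
      by (intro norm_inner_diff_le s t)
    also have "\<dots> \<le> hnorm X (s m - s n) * D + C * hnorm X (t m - t n)"
      using that C D by (intro add_mono mult_mono) auto
    also have "\<dots> < \<delta> * D + C * \<delta>"
      using that N1 N2 C(1) D(1) by (intro add_strict_mono mult_strict_right_mono mult_strict_left_mono) auto
    finally show ?thesis using \<delta>(2) by simp
  qed
  then show "\<exists>N. \<forall>m\<ge>N. \<forall>n\<ge>N. norm (hip X (s m) (t m) - hip X (s n) (t n)) < \<epsilon>" by blast
qed

lemma hconverges_cauchy:
  assumes s: "hconverges X s x" "\<And>n. s n \<in> hcarrier X" and x: "x \<in> hcarrier X"
  shows "hcauchy X s"
  unfolding hcauchy_def
proof (intro allI impI)
  fix \<epsilon> :: real assume "0 < \<epsilon>"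
  then obtain N where N: "\<forall>n\<ge>N. hnorm X (s n - x) < \<epsilon> / 2"
    using LIMSEQ_D[OF s(1)[unfolded hconverges_def], of "\<epsilon> / 2"] by auto
  have "hnorm X (s m - s n) < \<epsilon>" if "N \<le> m" "N \<le> n" for m n
    using hnorm_diff_triangle[of "s m" x "s n"] s(2) x N[rule_format, OF that(1)]
      N[rule_format, OF that(2)] hnorm_diff_commute[of x "s n"] by simp
  then show "\<exists>N. \<forall>m\<ge>N. \<forall>n\<ge>N. hnorm X (s m - s n) < \<epsilon>" by blast
qed

lemma hcauchy_dominated:
  assumes s: "hcauchy X s" and t: "hcauchy X t" and "0 \<le> K"
    and le: "\<And>m n. hnorm X (u m - u n) \<le> K * (hnorm X (s m - s n) + hnorm X (t m - t n))"
  shows "hcauchy X u"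
  unfolding hcauchy_def
proof (intro allI impI)
  fix \<epsilon> :: real assume "0 < \<epsilon>"
  define \<delta> where "\<delta> = \<epsilon> / (2 * (K + 1))"
  have \<delta>: "0 < \<delta>" "K * (\<delta> + \<delta>) < \<epsilon>"
    using \<open>0 < \<epsilon>\<close> \<open>0 \<le> K\<close> by (auto simp: \<delta>_def divide_simps)
  obtain N where N: "\<forall>m\<ge>N. \<forall>n\<ge>N. hnorm X (s m - s n) < \<delta>"
    using hcauchyD[OF s \<delta>(1)] by auto
  obtain M where M: "\<forall>m\<ge>M. \<forall>n\<ge>M. hnorm X (t m - t n) < \<delta>"
    using hcauchyD[OF t \<delta>(1)] by auto
  have "hnorm X (u m - u n) < \<epsilon>" if "max N M \<le> m" "max N M \<le> n" for m n
  proof -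
    have "K * (hnorm X (s m - s n) + hnorm X (t m - t n)) \<le> K * (\<delta> + \<delta>)"
      using that N M \<open>0 \<le> K\<close> by (intro mult_left_mono add_mono) (auto intro: less_imp_le)
    with le[of m n] \<delta>(2) show ?thesis by linarith
  qed
  then show "\<exists>N. \<forall>m\<ge>N. \<forall>n\<ge>N. hnorm X (u m - u n) < \<epsilon>" by blast
qed

lemma hcauchy_add:
  assumes "hcauchy X s" "\<And>n. s n \<in> hcarrier X" "hcauchy X t" "\<And>n. t n \<in> hcarrier X"
  shows "hcauchy X (\<lambda>n. s n + t n)"
proof (rule hcauchy_dominated[OF assms(1,3), of 1])
  fix m n
  have eq: "s m + t m - (s n + t n) = (s m - s n) + (t m - t n)" by simp
  show "hnorm X (s m + t m - (s n + t n)) \<le> 1 * (hnorm X (s m - s n) + hnorm X (t m - t n))"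
    unfolding eq using hnorm_triangle[of "s m - s n" "t m - t n"] assms by (simp add: diff_mem)
qed simp

lemma hnorm_act_le:
  assumes "x \<in> hcarrier X"
  shows "hnorm X (hact X x a) \<le> norm a * hnorm X x"
proof (rule power2_le_imp_le)
  have "norm (star a * hip X x x * a) \<le> norm (star a) * norm (hip X x x) * norm a"
    by (meson norm_mult_ineq order_trans mult_right_mono norm_ge_zero)
  then show "(hnorm X (hact X x a))\<^sup>2 \<le> (norm a * hnorm X x)\<^sup>2"
    using assms
    by (simp add: hnorm_square inner_simps mem_simps norm_star power_mult_distrib)
      (simp add: power2_eq_square mult_ac)
qed simp

lemma tendsto_inner_right:
  assumes t: "hconverges X t y" "\<And>n. t n \<in> hcarrier X" "y \<in> hcarrier X" and x: "x \<in> hcarrier X"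
  shows "(\<lambda>n. hip X x (t n)) \<longlonglongrightarrow> hip X x y"
proof (rule LIM_zero_cancel, rule Lim_null_comparison)
  show "\<forall>\<^sub>F n in sequentially. norm (hip X x (t n) - hip X x y) \<le> hnorm X x * hnorm X (t n - y)"
    using cauchy_schwarz[OF x diff_mem[OF t(2) t(3)]] t x
    by (simp add: inner_diff)
  show "(\<lambda>n. hnorm X x * hnorm X (t n - y)) \<longlonglongrightarrow> 0"
    using tendsto_mult_right_zero[OF t(1)[unfolded hconverges_def]] by simp
qed

lemma tendsto_inner_left:
  assumes t: "hconverges X t y" "\<And>n. t n \<in> hcarrier X" "y \<in> hcarrier X" and x: "x \<in> hcarrier X"
  shows "(\<lambda>n. hip X (t n) x) \<longlonglongrightarrow> hip X y x"
  using tendsto_star[OF tendsto_inner_right[OF assms]] t x by (simp add: inner_star)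

lemma combination_mem: "(\<And>i. e i \<in> hcarrier X) \<Longrightarrow> combination X e xs \<in> hcarrier X"
  by (induction xs) (simp_all add: mem_simps)

lemma combination_diff:
  assumes "\<And>i. e i \<in> hcarrier X"
  shows "combination X e xs - combination X e ys
    = combination X e (xs @ map (\<lambda>(i, b). (i, - b)) ys)"
proof -
  have "combination X e (map (\<lambda>(i, b). (i, - b)) ys) = - combination X e ys"
    by (induction ys) (auto simp: act_neg assms)
  then show ?thesis by simp
qed

lemma inner_combination:
  "(\<And>i. e i \<in> hcarrier X) \<Longrightarrow> y \<in> hcarrier X \<Longrightarrow>
    hip X (combination X e xs) y = (\<Sum>(i, b)\<leftarrow>xs. star b * hip X (e i) y)"
  by (induction xs) (auto simp: inner_simps mem_simps combination_mem)

lemma inner_combination_right: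
  "(\<And>i. e i \<in> hcarrier X) \<Longrightarrow> y \<in> hcarrier X \<Longrightarrow>
    hip X y (combination X e xs) = (\<Sum>(i, b)\<leftarrow>xs. hip X y (e i) * b)"
  by (induction xs) (auto simp: inner_simps mem_simps combination_mem)

end

section \<open>Total families and unitaries between Hilbert modules\<close>

text \<open>
  This is density of the \<open>A\<close>-linear span of the family. A vector \<open>x\<close> is cyclic iff the family
  \<open>\<rho>(a) v(g) x\<close> is total (\<open>cyclic_iff_total\<close>).
\<close>

definition total_family :: "('x::ab_group_add, 'a::unital_cstar_algebra) hmod \<Rightarrow> ('i \<Rightarrow> 'x) \<Rightarrow> bool" where
  "total_family X e \<longleftrightarrow> (\<forall>i. e i \<in> hcarrier X) \<and>
    (\<forall>y\<in>hcarrier X. \<forall>\<epsilon>>0. \<exists>xs. hnorm X (y - combination X e xs) < \<epsilon>)"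

lemma (in pre_hilbert_module) total_family_sequence:
  assumes "total_family X e" "y \<in> hcarrier X"
  obtains xs where "hconverges X (\<lambda>n. combination X e (xs n)) y"
proof -
  have "\<forall>n. \<exists>xs. hnorm X (y - combination X e xs) < inverse (real (Suc n))"
    using assms by (simp add: total_family_def)
  then obtain xs where xs: "\<And>n. hnorm X (y - combination X e (xs n)) < inverse (real (Suc n))"
    by metis
  have "hnorm X (combination X e (xs n) - y) \<le> inverse (real (Suc n))" for n
    using xs[of n] assms hnorm_diff_commute[of y "combination X e (xs n)"]
    by (simp add: total_family_def combination_mem)
  then have "hconverges X (\<lambda>n. combination X e (xs n)) y"
    unfolding hconverges_def
    by (intro real_tendsto_sandwich[OF _ _ tendsto_const LIMSEQ_inverse_real_of_nat]) auto
  with that show thesis by blast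
qed

context hilbert_module
begin

lemma hcauchy_hconverges:
  assumes "hcauchy X s" "\<And>n. s n \<in> hcarrier X"
  obtains x where "x \<in> hcarrier X" "hconverges X s x"
  using complete[of s] assms unfolding hcauchy_def hconverges_def by blast

text \<open>
  The difference \<open>y - z\<close> is orthogonal to a dense set, hence to itself.
\<close>

lemma total_family_separates:
  assumes e: "total_family X e" and y: "y \<in> hcarrier X" and z: "z \<in> hcarrier X"
    and eq: "\<And>i. hip X (e i) y = hip X (e i) z"
  shows "y = z"
proof -
  have mem: "\<And>i. e i \<in> hcarrier X" using e by (simp add: total_family_def)
  obtain xs where xs: "hconverges X (\<lambda>n. combination X e (xs n)) (y - z)"
    using total_family_sequence[OF e diff_mem[OF y z]] by blast
  have "hip X (combination X e (xs n)) (y - z) = 0" for n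
    by (simp add: inner_combination mem y z diff_mem inner_diff eq case_prod_beta')
  then have "(\<lambda>n. 0) \<longlonglongrightarrow> hip X (y - z) (y - z)"
    using tendsto_inner_left[OF xs combination_mem[OF mem] diff_mem[OF y z] diff_mem[OF y z]] by simp
  then have "hip X (y - z) (y - z) = 0" by (simp add: LIMSEQ_const_iff)
  then show ?thesis using ip_definite[OF diff_mem[OF y z]] by simp
qed

end

text \<open>
  Two total families with the same Gram matrix. The unitary is not defined on the span and extended;
  instead the image of \<open>x\<close> is the vector with the same inner products against the second family
  as \<open>x\<close> has against the first. Such a vector is unique by totality, which makes inverses and
  intertwining relations immediate. Approximation by combinations only enters to show that the
  vector exists and that inner products are preserved.
\<close>

locale equal_gram = X: hilbert_module X + Y: hilbert_module Y
  for X :: "('x::ab_group_add, 'a::unital_cstar_algebra) hmod"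
    and Y :: "('y::ab_group_add, 'a) hmod" +
  fixes e :: "'i \<Rightarrow> 'x" and f :: "'i \<Rightarrow> 'y"
  assumes total_e: "total_family X e" and total_f: "total_family Y f"
    and gram: "hip Y (f i) (f j) = hip X (e i) (e j)"
begin

definition transport :: "'x \<Rightarrow> 'y" where
  "transport x = (SOME y. y \<in> hcarrier Y \<and> (\<forall>i. hip Y (f i) y = hip X (e i) x))"

lemma e_mem: "e i \<in> hcarrier X" and f_mem: "f i \<in> hcarrier Y"
  using total_e total_f by (auto simp: total_family_def)

lemma inner_combinations:
  "hip Y (combination Y f xs) (combination Y f ys) = hip X (combination X e xs) (combination X e ys)"
  by (simp add: X.inner_combination Y.inner_combination X.inner_combination_right
      Y.inner_combination_right X.combination_mem Y.combination_mem e_mem f_mem gram)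

lemma hnorm_combination_diff:
  "hnorm Y (combination Y f xs - combination Y f ys) = hnorm X (combination X e xs - combination X e ys)"
  by (simp only: X.combination_diff Y.combination_diff e_mem f_mem hnorm_def inner_combinations)

lemma transport_sequence:
  assumes x: "x \<in> hcarrier X"
  obtains xs y where "y \<in> hcarrier Y" "hconverges X (\<lambda>n. combination X e (xs n)) x"
    "hconverges Y (\<lambda>n. combination Y f (xs n)) y" "\<And>i. hip Y (f i) y = hip X (e i) x"
proof -
  obtain xs where xs: "hconverges X (\<lambda>n. combination X e (xs n)) x"
    using X.total_family_sequence[OF total_e x] by blast
  have "hcauchy X (\<lambda>n. combination X e (xs n))"
    by (rule X.hconverges_cauchy[OF xs]) (auto simp: X.combination_mem e_mem x)
  then have "hcauchy Y (\<lambda>n. combination Y f (xs n))"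
    by (simp add: hcauchy_def hnorm_combination_diff)
  then obtain y where y: "y \<in> hcarrier Y" "hconverges Y (\<lambda>n. combination Y f (xs n)) y"
    by (rule Y.hcauchy_hconverges) (auto simp: Y.combination_mem f_mem)
  have "hip Y (f i) y = hip X (e i) x" for i
  proof (rule LIMSEQ_unique)
    show "(\<lambda>n. hip Y (f i) (combination Y f (xs n))) \<longlonglongrightarrow> hip Y (f i) y"
      by (rule Y.tendsto_inner_right[OF y(2)]) (auto simp: Y.combination_mem f_mem y)
    have "(\<lambda>n. hip X (e i) (combination X e (xs n))) \<longlonglongrightarrow> hip X (e i) x"
      by (rule X.tendsto_inner_right[OF xs]) (auto simp: X.combination_mem e_mem x)
    then show "(\<lambda>n. hip Y (f i) (combination Y f (xs n))) \<longlonglongrightarrow> hip X (e i) x"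
      by (simp add: X.inner_combination_right Y.inner_combination_right e_mem f_mem gram)
  qed
  with y xs that show thesis by blast
qed

lemma transport:
  assumes "x \<in> hcarrier X"
  shows "transport x \<in> hcarrier Y" "hip Y (f i) (transport x) = hip X (e i) x"
proof -
  have "\<exists>y. y \<in> hcarrier Y \<and> (\<forall>i. hip Y (f i) y = hip X (e i) x)"
    using transport_sequence[OF assms] by metis
  from someI_ex[OF this, folded transport_def]
  show "transport x \<in> hcarrier Y" "hip Y (f i) (transport x) = hip X (e i) x" by auto
qed

lemma transport_unique:
  assumes "x \<in> hcarrier X" "y \<in> hcarrier Y" "\<And>i. hip Y (f i) y = hip X (e i) x"
  shows "transport x = y"
  using assms by (intro Y.total_family_separates[OF total_f]) (auto simp: transport)

lemma inner_transport:
  assumes x: "x \<in> hcarrier X" and z: "z \<in> hcarrier X"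
  shows "hip Y (transport x) (transport z) = hip X x z"
proof -
  obtain xs y where y: "y \<in> hcarrier Y" and xs: "hconverges X (\<lambda>n. combination X e (xs n)) x"
    and ys: "hconverges Y (\<lambda>n. combination Y f (xs n)) y" and eq: "\<And>i. hip Y (f i) y = hip X (e i) x"
    using transport_sequence[OF x] by blast
  have "(\<lambda>n. hip X (combination X e (xs n)) z) \<longlonglongrightarrow> hip X x z"
    by (rule X.tendsto_inner_left[OF xs]) (auto simp: X.combination_mem e_mem x z)
  then have "(\<lambda>n. hip Y (combination Y f (xs n)) (transport z)) \<longlonglongrightarrow> hip X x z"
    by (simp add: X.inner_combination Y.inner_combination e_mem f_mem transport z)
  moreover have "(\<lambda>n. hip Y (combination Y f (xs n)) (transport z)) \<longlonglongrightarrow> hip Y (transport x) (transport z)"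
    unfolding transport_unique[OF x y eq]
    by (rule Y.tendsto_inner_left[OF ys]) (auto simp: Y.combination_mem f_mem y z transport)
  ultimately show ?thesis using LIMSEQ_unique by blast
qed

end

lemma (in equal_gram) flip: "equal_gram Y X f e"
  by unfold_locales (simp_all add: total_e total_f gram)

lemma (in equal_gram) is_unitary_transport:
  "is_unitary X Y transport (equal_gram.transport Y X f e)"
proof -
  interpret flip: equal_gram Y X f e by (rule flip)
  have inv: "flip.transport (transport x) = x" if "x \<in> hcarrier X" for x
    by (rule flip.transport_unique) (auto simp: transport that)
  have inv': "transport (flip.transport y) = y" if "y \<in> hcarrier Y" for y
    by (rule transport_unique) (auto simp: flip.transport that)
  have "hip Y (transport x) y = hip X x (flip.transport y)" if "x \<in> hcarrier X" "y \<in> hcarrier Y" for x y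
    using inner_transport[OF that(1) flip.transport(1)[OF that(2)]] by (simp add: inv' that)
  with inv inv' show ?thesis
    by (auto simp: is_unitary_def is_adjoint_def transport flip.transport)
qed

section \<open>The Hilbert module of a positive kernel\<close>

text \<open>
  A positive kernel on pairs of indices. Elements of its module are functions on these pairs, and
  \<open>kernel_at s\<close> is the vector that evaluates functions at \<open>s\<close>. The indices are curried to fit the type of
  the module that is constructed in the end.
\<close>

locale positive_kernel =
  fixes k :: "'i \<Rightarrow> 'j \<Rightarrow> 'i \<Rightarrow> 'j \<Rightarrow> 'a::unital_cstar_algebra"
  assumes kernel_positive: "positive_matrix n (\<lambda>l m. k (p l) (q l) (p m) (q m))"
begin

definition kernel_at :: "'i \<times> 'j \<Rightarrow> 'i \<Rightarrow> 'j \<Rightarrow> 'a" where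
  "kernel_at s = (\<lambda>i j. k i j (fst s) (snd s))"

definition kernel_span :: "(('i \<times> 'j) \<times> 'a) list \<Rightarrow> 'i \<Rightarrow> 'j \<Rightarrow> 'a" where
  "kernel_span xs = (\<lambda>i j. \<Sum>(s, b)\<leftarrow>xs. k i j (fst s) (snd s) * b)"

definition pairing :: "(('i \<times> 'j) \<times> 'a) list \<Rightarrow> ('i \<Rightarrow> 'j \<Rightarrow> 'a) \<Rightarrow> 'a" where
  "pairing xs f = (\<Sum>(s, b)\<leftarrow>xs. star b * f (fst s) (snd s))"

text \<open>
  The inner product is \<open>\<langle>\<Sum> K(\<cdot>, s) b, f\<rangle> = \<Sum> b\<^sup>* f(s)\<close>. It is defined through an arbitrarily
  chosen representation of its first argument. By Hermitian symmetry of the kernel, the choice is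
  irrelevant if \<open>f\<close> is in the span (\<open>inner_kernel_span\<close>).
\<close>

definition span_module :: "('i \<Rightarrow> 'j \<Rightarrow> 'a, 'a) hmod" where
  "span_module = \<lparr>hcarrier = range kernel_span, hscale = (\<lambda>c f i j. c *\<^sub>C f i j),
     hact = (\<lambda>f b i j. f i j * b), hip = (\<lambda>f g. pairing (SOME xs. kernel_span xs = f) g)\<rparr>"

lemma span_module_simps [simp]:
  "hcarrier span_module = range kernel_span"
  "hact span_module f b i j = f i j * b"
  by (simp_all add: span_module_def)

lemma kernel_span_simps [simp]:
  "kernel_span [] i j = 0"
  "kernel_span (x # xs) i j = k i j (fst (fst x)) (snd (fst x)) * snd x + kernel_span xs i j"
  by (simp_all add: kernel_span_def split_beta)

lemma pairing_simps [simp]: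
  "pairing [] f = 0"
  "pairing (x # xs) f = star (snd x) * f (fst (fst x)) (snd (fst x)) + pairing xs f"
  by (simp_all add: pairing_def split_beta)

lemma kernel_span_append: "kernel_span (xs @ ys) = kernel_span xs + kernel_span ys"
  by (simp add: kernel_span_def fun_eq_iff)

lemma kernel_span_act: "hact span_module (kernel_span xs) a = kernel_span (map (\<lambda>(s, b). (s, b * a)) xs)"
proof -
  have "kernel_span xs i j * a = kernel_span (map (\<lambda>(s, b). (s, b * a)) xs) i j" for i j
    by (induction xs) (auto simp: algebra_simps)
  then show ?thesis by (simp add: fun_eq_iff)
qed

lemma kernel_at_eq: "kernel_at s = kernel_span [(s, 1)]"
  by (simp add: kernel_at_def kernel_span_def)

lemma pairing_add: "pairing xs (f + g) = pairing xs f + pairing xs g"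
  by (induction xs) (simp_all add: algebra_simps)

lemma pairing_act: "pairing xs (hact span_module f a) = pairing xs f * a"
  by (induction xs) (simp_all add: algebra_simps)

lemma kernel_star: "star (k i j p q) = k p q i j"
proof -
  obtain B where B: "\<forall>l<2. \<forall>m<2. k ([i, p] ! l) ([j, q] ! l) ([i, p] ! m) ([j, q] ! m)
      = (\<Sum>r<(2::nat). star (B r l) * B r m)"
    using kernel_positive[of 2 "\<lambda>l. [i, p] ! l" "\<lambda>l. [j, q] ! l"]
    by (auto simp: positive_matrix_def)
  have "k i j p q = (\<Sum>r<(2::nat). star (B r 0) * B r 1)" "k p q i j = (\<Sum>r<(2::nat). star (B r 1) * B r 0)"
    using B[rule_format, of 0 1] B[rule_format, of 1 0] by simp_all
  then show ?thesis by (simp add: star_sum star_mult star_star)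
qed

lemma star_kernel_span: "star (kernel_span ys (fst s) (snd s)) * b = pairing ys (\<lambda>i j. kernel_at s i j * b)"
  by (induction ys) (simp_all add: star_add star_mult kernel_star kernel_at_def distrib_right mult.assoc)

lemma pairing_kernel_span_Cons:
  "pairing ys (kernel_span (x # xs))
    = pairing ys (\<lambda>i j. kernel_at (fst x) i j * snd x) + pairing ys (kernel_span xs)"
proof -
  have "kernel_span (x # xs) = (\<lambda>i j. kernel_at (fst x) i j * snd x) + kernel_span xs"
    by (simp add: fun_eq_iff kernel_at_def)
  then show ?thesis by (simp add: pairing_add)
qed

lemma pairing_zero: "pairing ys (kernel_span []) = 0"
  by (induction ys) simp_all

lemma star_pairing: "star (pairing xs (kernel_span ys)) = pairing ys (kernel_span xs)"
  by (induction xs)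
    (simp_all only: pairing_kernel_span_Cons pairing_simps star_add star_mult star_star
      star_kernel_span pairing_zero star_zero)

text \<open>
  Writing the kernel matrix as \<open>B\<^sup>* B\<close> turns the quadratic form into a sum of \<open>n\<close> elements of the
  form \<open>c\<^sup>* c\<close>; that such a sum is again of this form is the convexity of the positive cone.
\<close>

lemma positive_pairing: "positive_element (pairing xs (kernel_span xs))"
proof -
  define n where "n = length xs"
  define p where "p l = fst (fst (xs ! l))" for l
  define q where "q l = snd (fst (xs ! l))" for l
  define b where "b l = snd (xs ! l)" for l
  obtain B where B: "\<forall>l<n. \<forall>m<n. k (p l) (q l) (p m) (q m) = (\<Sum>r<n. star (B r l) * B r m)"
    using kernel_positive[of n p q] by (auto simp: positive_matrix_def)
  have "pairing xs (kernel_span xs) = (\<Sum>l<n. star (b l) * (\<Sum>m<n. k (p l) (q l) (p m) (q m) * b m))"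
    by (simp add: pairing_def kernel_span_def sum_list_sum_nth split_beta atLeast0LessThan
        n_def p_def q_def b_def)
  also have "\<dots> = (\<Sum>l<n. \<Sum>m<n. \<Sum>r<n. star (B r l * b l) * (B r m * b m))"
    using B by (simp add: sum_distrib_left sum_distrib_right star_mult mult.assoc)
  also have "\<dots> = (\<Sum>l<n. \<Sum>r<n. \<Sum>m<n. star (B r l * b l) * (B r m * b m))"
    by (intro sum.cong sum.swap refl)
  also have "\<dots> = (\<Sum>r<n. \<Sum>l<n. \<Sum>m<n. star (B r l * b l) * (B r m * b m))"
    by (rule sum.swap)
  also have "\<dots> = (\<Sum>r<n. star (\<Sum>l<n. B r l * b l) * (\<Sum>m<n. B r m * b m))"
    by (simp add: star_sum sum_product)
  finally show ?thesis by (simp add: positive_sum positive_star_mult)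
qed

lemma inner_kernel_span:
  assumes "f \<in> range kernel_span"
  shows "hip span_module (kernel_span xs) f = pairing xs f"
proof -
  define zs where "zs = (SOME zs. kernel_span zs = kernel_span xs)"
  have "kernel_span zs = kernel_span xs" unfolding zs_def by (rule someI[of _ xs]) simp
  then have "pairing zs f = pairing xs f"
    using assms star_pairing by (metis imageE)
  then show ?thesis by (simp add: span_module_def zs_def)
qed

lemma span_add_mem: "f \<in> range kernel_span \<Longrightarrow> g \<in> range kernel_span \<Longrightarrow> f + g \<in> range kernel_span"
  by (auto simp: kernel_span_append[symmetric])

lemma span_act_mem: "f \<in> range kernel_span \<Longrightarrow> hact span_module f a \<in> range kernel_span"
  by (auto simp: kernel_span_act)

lemma pre_hilbert_span_module: "pre_hilbert_module span_module"
proof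
  have "(0 :: 'i \<Rightarrow> 'j \<Rightarrow> 'a) = kernel_span []" by (simp add: fun_eq_iff)
  then show "0 \<in> hcarrier span_module" by simp
next
  fix f g h :: "'i \<Rightarrow> 'j \<Rightarrow> 'a" and a b
  assume f: "f \<in> hcarrier span_module"
  then obtain xs where xs: "f = kernel_span xs" by auto
  show "hact span_module f a \<in> hcarrier span_module" using f by (simp add: span_act_mem)
  show "hact span_module f (a + b) = hact span_module f a + hact span_module f b"
    by (simp add: fun_eq_iff distrib_left)
  show "hact span_module f 1 = f" by (simp add: fun_eq_iff)
  show "positive_element (hip span_module f f)"
    using f xs by (simp add: inner_kernel_span positive_pairing)
  assume g: "g \<in> hcarrier span_module"
  then obtain ys where ys: "g = kernel_span ys" by auto
  show "f + g \<in> hcarrier span_module" using f g by (simp add: span_add_mem)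
  show "hip span_module f (hact span_module g a) = hip span_module f g * a"
    using g xs by (simp add: inner_kernel_span span_act_mem pairing_act)
  show "star (hip span_module f g) = hip span_module g f"
    using f g xs ys by (simp add: inner_kernel_span star_pairing)
  assume h: "h \<in> hcarrier span_module"
  show "hip span_module f (g + h) = hip span_module f g + hip span_module f h"
    using g h xs by (simp add: inner_kernel_span span_add_mem pairing_add)
qed

sublocale span: pre_hilbert_module span_module
  by (rule pre_hilbert_span_module)

lemma kernel_at_mem: "kernel_at s \<in> range kernel_span"
  by (simp add: kernel_at_eq)

lemma inner_kernel_at: "f \<in> range kernel_span \<Longrightarrow> hip span_module (kernel_at s) f = f (fst s) (snd s)"
  by (simp add: kernel_at_eq inner_kernel_span)

text \<open>
  The completion consists of the pointwise limits of Cauchy sequences from the span. This is a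
  faithful model, because a Cauchy sequence that tends to zero pointwise tends to zero in norm
  (\<open>hnorm_null_sequence\<close>).
\<close>

definition approximates :: "(nat \<Rightarrow> 'i \<Rightarrow> 'j \<Rightarrow> 'a) \<Rightarrow> ('i \<Rightarrow> 'j \<Rightarrow> 'a) \<Rightarrow> bool" where
  "approximates w f \<longleftrightarrow> (\<forall>n. w n \<in> range kernel_span) \<and> hcauchy span_module w \<and>
     (\<forall>i j. (\<lambda>n. w n i j) \<longlonglongrightarrow> f i j)"

definition kernel_module :: "('i \<Rightarrow> 'j \<Rightarrow> 'a, 'a) hmod" where
  "kernel_module = \<lparr>hcarrier = {f. \<exists>w. approximates w f}, hscale = (\<lambda>c f i j. c *\<^sub>C f i j),
     hact = (\<lambda>f b i j. f i j * b),
     hip = (\<lambda>f g. lim (\<lambda>n. hip span_module ((SOME w. approximates w f) n) ((SOME w. approximates w g) n)))\<rparr>"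

lemma kernel_module_simps [simp]:
  "f \<in> hcarrier kernel_module \<longleftrightarrow> (\<exists>w. approximates w f)"
  "hscale kernel_module c f = (\<lambda>i j. c *\<^sub>C f i j)"
  "hact kernel_module f b = (\<lambda>i j. f i j * b)"
  by (simp_all add: kernel_module_def)

lemma approximatesD:
  assumes "approximates w f"
  shows "w n \<in> range kernel_span" "hcauchy span_module w" "(\<lambda>n. w n i j) \<longlonglongrightarrow> f i j"
  using assms by (simp_all add: approximates_def)

lemma approximates_const: "f \<in> range kernel_span \<Longrightarrow> approximates (\<lambda>n. f) f"
  using span.inner_zero[OF span.zero_mem] by (simp add: approximates_def hcauchy_def hnorm_def)

lemma approximates_add: 
  assumes "approximates w f" "approximates u g"
  shows "approximates (\<lambda>n. w n + u n) (f + g)"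
  using assms span.hcauchy_add[of w u] span.add_mem
  by (auto simp: approximates_def intro: tendsto_add)

lemma approximates_act:
  assumes "approximates w f"
  shows "approximates (\<lambda>n. hact span_module (w n) a) (\<lambda>i j. f i j * a)"
proof -
  have "hcauchy span_module (\<lambda>n. hact span_module (w n) a)"
  proof (rule span.hcauchy_dominated[of w w])
    fix m n
    have eq: "hact span_module (w m) a - hact span_module (w n) a = hact span_module (w m - w n) a"
      by (simp add: fun_eq_iff algebra_simps)
    show "hnorm span_module (hact span_module (w m) a - hact span_module (w n) a)
        \<le> norm a * (hnorm span_module (w m - w n) + hnorm span_module (w m - w n))"
      unfolding eq using span.hnorm_act_le[of "w m - w n" a] approximatesD[OF assms]
        mult_left_mono[of "hnorm span_module (w m - w n)" "hnorm span_module (w m - w n) + hnorm span_module (w m - w n)" "norm a"]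
      by (auto simp: span.diff_mem[simplified] intro: order_trans)
  qed (use approximatesD[OF assms] in auto)
  then show ?thesis
    using assms span.act_mem by (auto simp: approximates_def intro: tendsto_mult_right)
qed

lemma approximates_diff:
  assumes "approximates w f" "approximates u g"
  shows "approximates (\<lambda>n. w n - u n) (f - g)"
proof -
  have "hact span_module (u n) (- 1) = - u n" for n by (simp add: fun_eq_iff)
  moreover have "(\<lambda>i j. g i j * - 1) = - g" by (simp add: fun_eq_iff)
  ultimately show ?thesis
    using approximates_add[OF assms(1) approximates_act[OF assms(2), of "- 1"]] by simp
qed

lemma tendsto_pairing:
  "(\<And>i j. (\<lambda>n. w n i j) \<longlonglongrightarrow> f i j) \<Longrightarrow> (\<lambda>n. pairing xs (w n)) \<longlonglongrightarrow> pairing xs f"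
  by (induction xs) (auto intro!: tendsto_add tendsto_mult_left)

text \<open>
  For fixed \<open>N\<close> the inner product \<open>\<langle>w N, w n\<rangle>\<close> is a finite sum of values of \<open>w n\<close> with fixed
  coefficients, so it tends to zero, and \<open>w n\<close> differs little from \<open>w N\<close> for large \<open>N\<close>.
\<close>

lemma hnorm_null_sequence:
  assumes w: "approximates w 0"
  shows "(\<lambda>n. hnorm span_module (w n)) \<longlonglongrightarrow> 0"
proof -
  note wD = approximatesD[OF w]
  have mem: "w n \<in> hcarrier span_module" for n using wD(1) by simp
  obtain L where L: "(\<lambda>n. hip span_module (w n) (w n)) \<longlonglongrightarrow> L"
    using span.convergent_inner[OF wD(2) mem wD(2) mem] by (auto simp: convergent_def)
  obtain C M where C: "0 < C" "\<And>n. M \<le> n \<Longrightarrow> hnorm span_module (w n) \<le> C"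
    using span.hcauchy_bounded[OF wD(2) mem] by blast
  have "norm L \<le> \<epsilon>" if "0 < \<epsilon>" for \<epsilon>
  proof -
    have "0 < \<epsilon> / C" using that C(1) by simp
    then obtain N where N: "\<forall>m\<ge>N. \<forall>n\<ge>N. hnorm span_module (w m - w n) < \<epsilon> / C"
      using hcauchyD[OF wD(2)] by blast
    obtain xs where xs: "w N = kernel_span xs" using wD(1) by blast
    have fixed: "(\<lambda>n. hip span_module (w N) (w n)) \<longlonglongrightarrow> 0"
    proof -
      have "pairing xs 0 = 0" by (induction xs) simp_all
      then show ?thesis using tendsto_pairing[of w 0 xs] wD(1,3) by (simp add: xs inner_kernel_span)
    qed
    have "norm (hip span_module (w n) (w n)) \<le> \<epsilon> + norm (hip span_module (w N) (w n))"
      if n: "max M N \<le> n" for n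
    proof -
      have "hip span_module (w n) (w n) = hip span_module (w n - w N) (w n) + hip span_module (w N) (w n)"
        using mem by (simp only: span.inner_diff_left) simp
      then have "norm (hip span_module (w n) (w n))
          \<le> norm (hip span_module (w n - w N) (w n)) + norm (hip span_module (w N) (w n))"
        by (metis norm_triangle_ineq)
      moreover have "norm (hip span_module (w n - w N) (w n)) \<le> (\<epsilon> / C) * C"
      proof -
        have "norm (hip span_module (w n - w N) (w n)) \<le> hnorm span_module (w n - w N) * hnorm span_module (w n)"
          by (intro span.cauchy_schwarz span.diff_mem mem)
        also have "\<dots> \<le> (\<epsilon> / C) * C"
          using n N C \<open>0 < \<epsilon> / C\<close> by (intro mult_mono) (auto intro: less_imp_le)
        finally show ?thesis .
      qed
      ultimately show ?thesis using C(1) by simp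
    qed
    then have "norm L \<le> \<epsilon> + norm (0::'a)"
      by (intro LIMSEQ_le[OF tendsto_norm[OF L] tendsto_add[OF tendsto_const tendsto_norm[OF fixed]]]) blast
    then show ?thesis by simp
  qed
  then have "norm L \<le> 0" by (rule field_le_epsilon) simp
  then have "(\<lambda>n. hip span_module (w n) (w n)) \<longlonglongrightarrow> 0" using L by simp
  then show ?thesis
    using tendsto_real_sqrt[OF tendsto_norm_zero] by (fastforce simp: hnorm_def)
qed

lemma tendsto_inner_null:
  assumes w: "approximates w 0" and u: "approximates u g"
  shows "(\<lambda>n. hip span_module (w n) (u n)) \<longlonglongrightarrow> 0"
proof -
  have mem: "w n \<in> hcarrier span_module" "u n \<in> hcarrier span_module" for n
    using approximatesD[OF w] approximatesD[OF u] by simp_all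
  obtain C M where C: "0 < C" "\<And>n. M \<le> n \<Longrightarrow> hnorm span_module (u n) \<le> C"
    using span.hcauchy_bounded[OF approximatesD(2)[OF u] mem(2)] by blast
  have "norm (hip span_module (w n) (u n)) \<le> hnorm span_module (w n) * C" if "M \<le> n" for n
    using span.cauchy_schwarz[OF mem] C(2)[OF that] 
      mult_left_mono[of "hnorm span_module (u n)" C "hnorm span_module (w n)"]
    by (meson order_trans hnorm_nonneg)
  then have "\<forall>\<^sub>F n in sequentially. norm (hip span_module (w n) (u n)) \<le> hnorm span_module (w n) * C"
    by (auto simp: eventually_sequentially)
  then show ?thesis
    by (rule Lim_null_comparison) (rule tendsto_mult_left_zero[OF hnorm_null_sequence[OF w]])
qed

text \<open>
  The limit does not depend on the approximating sequences, because the difference of two sequences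
  for the same function approximates zero.
\<close>

lemma tendsto_inner:
  assumes w: "approximates w f" and u: "approximates u g"
  shows "(\<lambda>n. hip span_module (w n) (u n)) \<longlonglongrightarrow> hip kernel_module f g"
proof -
  define w' where "w' = (SOME w. approximates w f)"
  define u' where "u' = (SOME u. approximates u g)"
  have w': "approximates w' f" unfolding w'_def by (rule someI[of _ w]) (rule w)
  have u': "approximates u' g" unfolding u'_def by (rule someI[of _ u]) (rule u)
  have mem: "w n \<in> hcarrier span_module" "u n \<in> hcarrier span_module"
    "w' n \<in> hcarrier span_module" "u' n \<in> hcarrier span_module" for n
    using approximatesD[OF w] approximatesD[OF u] approximatesD[OF w'] approximatesD[OF u'] by simp_all
  have "convergent (\<lambda>n. hip span_module (w' n) (u' n))"
    by (intro span.convergent_inner approximatesD[OF w'] approximatesD[OF u'] mem)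
  then have lim: "(\<lambda>n. hip span_module (w' n) (u' n)) \<longlonglongrightarrow> hip kernel_module f g"
    by (simp add: kernel_module_def w'_def u'_def convergent_LIMSEQ_iff)
  have nw: "approximates (\<lambda>n. w n - w' n) 0" "approximates (\<lambda>n. u n - u' n) 0"
    using approximates_diff[OF w w'] approximates_diff[OF u u'] by simp_all
  \<comment> \<open>Telescope \<open>\<langle>w, u\<rangle> - \<langle>w', u'\<rangle>\<close> into two terms with one null factor each.\<close>
  have "(\<lambda>n. hip span_module (w n - w' n) (u n) + star (hip span_module (u n - u' n) (w' n)))
      \<longlonglongrightarrow> 0 + star 0"
    by (intro tendsto_add tendsto_star tendsto_inner_null[OF nw(1) u] tendsto_inner_null[OF nw(2) w'])
  moreover have "hip span_module (w n - w' n) (u n) + star (hip span_module (u n - u' n) (w' n))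
     = hip span_module (w n) (u n) - hip span_module (w' n) (u' n)" for n
    using mem by (simp only: star_diff span.inner_star span.inner_diff_left) simp
  ultimately have "(\<lambda>n. hip span_module (w n) (u n) - hip span_module (w' n) (u' n)) \<longlonglongrightarrow> 0"
    by simp
  from tendsto_add[OF this lim] show ?thesis by simp
qed

lemma inner_span: 
  assumes "f \<in> range kernel_span" "g \<in> range kernel_span"
  shows "hip kernel_module f g = hip span_module f g"
  using tendsto_inner[OF approximates_const[OF assms(1)] approximates_const[OF assms(2)]]
  by (simp add: LIMSEQ_const_iff)

lemma pre_hilbert_kernel_module: "pre_hilbert_module kernel_module"
proof
  show "0 \<in> hcarrier kernel_module"
    using approximates_const[OF span.zero_mem[simplified]] by auto
next
  fix f g h :: "'i \<Rightarrow> 'j \<Rightarrow> 'a" and a b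
  assume "f \<in> hcarrier kernel_module"
  then obtain w where w: "approximates w f" by auto
  show "hact kernel_module f a \<in> hcarrier kernel_module"
    using approximates_act[OF w] by fastforce
  show "hact kernel_module f (a + b) = hact kernel_module f a + hact kernel_module f b"
    by (simp add: fun_eq_iff distrib_left)
  show "hact kernel_module f 1 = f" by simp
  show "positive_element (hip kernel_module f f)"
    by (rule positive_limit[OF _ tendsto_inner[OF w w]])
      (use approximatesD(1)[OF w] span.inner_positive in simp)
  assume "g \<in> hcarrier kernel_module"
  then obtain u where u: "approximates u g" by auto
  show "f + g \<in> hcarrier kernel_module"
    using approximates_add[OF w u] by fastforce
  have "(\<lambda>n. hip span_module (w n) (hact span_module (u n) a)) \<longlonglongrightarrow> hip kernel_module f g * a"
    using tendsto_mult_right[OF tendsto_inner[OF w u], of a]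
      approximatesD(1)[OF w] approximatesD(1)[OF u]
    by (simp add: span.inner_act)
  then show "hip kernel_module f (hact kernel_module g a) = hip kernel_module f g * a"
    using LIMSEQ_unique[OF tendsto_inner[OF w approximates_act[OF u]]] by simp
  have "(\<lambda>n. hip span_module (u n) (w n)) \<longlonglongrightarrow> star (hip kernel_module f g)"
    using tendsto_star[OF tendsto_inner[OF w u]] approximatesD(1)[OF w] approximatesD(1)[OF u]
    by (simp add: span.inner_star)
  then show "star (hip kernel_module f g) = hip kernel_module g f"
    using tendsto_inner[OF u w] LIMSEQ_unique by blast
  assume "h \<in> hcarrier kernel_module"
  then obtain t where t: "approximates t h" by auto
  have "(\<lambda>n. hip span_module (w n) (u n + t n)) \<longlonglongrightarrow> hip kernel_module f g + hip kernel_module f h"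
    using tendsto_add[OF tendsto_inner[OF w u] tendsto_inner[OF w t]]
      approximatesD(1)[OF w] approximatesD(1)[OF u] approximatesD(1)[OF t]
    by (simp add: span.inner_add)
  then show "hip kernel_module f (g + h) = hip kernel_module f g + hip kernel_module f h"
    using tendsto_inner[OF w approximates_add[OF u t]] LIMSEQ_unique by blast
qed

sublocale completion: pre_hilbert_module kernel_module
  by (rule pre_hilbert_kernel_module)

lemma span_subset: "f \<in> range kernel_span \<Longrightarrow> f \<in> hcarrier kernel_module"
  using approximates_const by auto

lemma reproducing:
  assumes "f \<in> hcarrier kernel_module"
  shows "hip kernel_module (kernel_at s) f = f (fst s) (snd s)"
proof -
  obtain w where w: "approximates w f" using assms by auto
  show ?thesis
    using LIMSEQ_unique[OF tendsto_inner[OF approximates_const[OF kernel_at_mem] w]]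
      approximatesD(1,3)[OF w] by (simp add: inner_kernel_at)
qed

lemma hnorm_span: "f \<in> range kernel_span \<Longrightarrow> hnorm kernel_module f = hnorm span_module f"
  by (simp add: hnorm_def inner_span)

lemma approximates_hconverges:
  assumes w: "approximates w f"
  shows "hconverges kernel_module w f"
  unfolding hconverges_def
proof (rule LIMSEQ_I)
  fix \<epsilon> :: real assume "0 < \<epsilon>"
  then obtain N where N: "\<forall>m\<ge>N. \<forall>n\<ge>N. hnorm span_module (w m - w n) < \<epsilon> / 2"
    using hcauchyD[OF approximatesD(2)[OF w], of "\<epsilon> / 2"] by auto
  have "hnorm kernel_module (w n - f) \<le> \<epsilon> / 2" if n: "N \<le> n" for n
  proof -
    have a: "approximates (\<lambda>m. w n - w m) (w n - f)"
      by (intro approximates_diff w approximates_const approximatesD[OF w])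
    have "(\<lambda>m. hnorm span_module (w n - w m)) \<longlonglongrightarrow> hnorm kernel_module (w n - f)"
      unfolding hnorm_def by (intro tendsto_real_sqrt tendsto_norm tendsto_inner a)
    then show ?thesis
      by (rule LIMSEQ_le_const2) (use N n less_imp_le in blast)
  qed
  then show "\<exists>N. \<forall>n\<ge>N. norm (hnorm kernel_module (w n - f) - 0) < \<epsilon>"
    using \<open>0 < \<epsilon>\<close> by (intro exI[of _ N]) (auto intro: le_less_trans[of _ "\<epsilon> / 2"])
qed

lemma approximates_within:
  assumes "approximates w f" "0 < \<epsilon>"
  obtains n where "hnorm kernel_module (w n - f) < \<epsilon>"
  using LIMSEQ_D[OF approximates_hconverges[OF assms(1), unfolded hconverges_def] assms(2)] by auto

text \<open>
  Replace the terms of the sequence by nearby elements of the span. The new sequence is Cauchy in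
  the span, hence pointwise convergent by the reproducing property.
\<close>

lemma kernel_module_complete:
  assumes s: "hcauchy kernel_module s" "\<And>n. s n \<in> hcarrier kernel_module"
  obtains f where "f \<in> hcarrier kernel_module" "hconverges kernel_module s f"
proof -
  have "\<exists>w. w \<in> range kernel_span \<and> hnorm kernel_module (s n - w) < inverse (real (Suc n))" for n
  proof -
    obtain w where w: "approximates w (s n)" using s(2)[of n] by auto
    obtain m where "hnorm kernel_module (w m - s n) < inverse (real (Suc n))"
      using approximates_within[OF w, of "inverse (real (Suc n))"] by auto
    then show ?thesis
      using approximatesD(1)[OF w] completion.hnorm_diff_commute[OF s(2) span_subset] by metis
  qed
  then obtain w where w: "\<And>n. w n \<in> range kernel_span"
      "\<And>n. hnorm kernel_module (s n - w n) < inverse (real (Suc n))"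
    by metis
  have wX: "w n \<in> hcarrier kernel_module" for n by (rule span_subset[OF w(1)])
  have null: "(\<lambda>n. hnorm kernel_module (s n - w n)) \<longlonglongrightarrow> 0"
    by (rule real_tendsto_sandwich[OF _ _ tendsto_const LIMSEQ_inverse_real_of_nat])
      (rule always_eventually, use less_imp_le[OF w(2)] in auto)+
  have "hcauchy kernel_module w"
    unfolding hcauchy_def
  proof (intro allI impI)
    fix \<epsilon> :: real assume \<epsilon>: "0 < \<epsilon>"
    obtain N where N: "\<forall>n\<ge>N. hnorm kernel_module (s n - w n) < \<epsilon> / 3"
      using LIMSEQ_D[OF null, of "\<epsilon> / 3"] \<epsilon> by auto
    obtain M where M: "\<forall>m\<ge>M. \<forall>n\<ge>M. hnorm kernel_module (s m - s n) < \<epsilon> / 3"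
      using hcauchyD[OF s(1), of "\<epsilon> / 3"] \<epsilon> by auto
    have "hnorm kernel_module (w m - w n) < \<epsilon>" if "max N M \<le> m" "max N M \<le> n" for m n
    proof -
      have "hnorm kernel_module (w m - w n) \<le> hnorm kernel_module (w m - s m) + hnorm kernel_module (s m - w n)"
        by (intro completion.hnorm_diff_triangle wX s)
      moreover have "hnorm kernel_module (s m - w n) \<le> hnorm kernel_module (s m - s n) + hnorm kernel_module (s n - w n)"
        by (intro completion.hnorm_diff_triangle wX s)
      moreover have "hnorm kernel_module (w m - s m) = hnorm kernel_module (s m - w m)"
        by (intro completion.hnorm_diff_commute wX s)
      moreover have "N \<le> m" "N \<le> n" "M \<le> m" "M \<le> n" using that by simp_all
      ultimately show ?thesis
        using N[rule_format, of m] N[rule_format, of n] M[rule_format, of m n] by linarith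
    qed
    then show "\<exists>N. \<forall>m\<ge>N. \<forall>n\<ge>N. hnorm kernel_module (w m - w n) < \<epsilon>" by blast
  qed
  then have cw: "hcauchy span_module w"
    using w(1) span.diff_mem by (simp add: hcauchy_def hnorm_span)
  have "convergent (\<lambda>n. w n i j)" for i j
  proof -
    have "convergent (\<lambda>n. hip span_module (kernel_at (i, j)) (w n))"
      using approximatesD(2)[OF approximates_const[OF kernel_at_mem]] cw w(1)
      by (intro span.convergent_inner) (auto simp: kernel_at_mem)
    then show ?thesis by (simp add: inner_kernel_at w(1))
  qed
  then have "\<exists>l. (\<lambda>n. w n i j) \<longlonglongrightarrow> l" for i j by (simp add: convergent_def)
  then obtain f where "\<And>i j. (\<lambda>n. w n i j) \<longlonglongrightarrow> f i j" by metis
  with cw w(1) have f: "approximates w f" by (simp add: approximates_def)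
  then have fX: "f \<in> hcarrier kernel_module" by auto
  have "hconverges kernel_module s f"
    unfolding hconverges_def
  proof (rule real_tendsto_sandwich[OF _ _ tendsto_const])
    show "\<forall>\<^sub>F n in sequentially. hnorm kernel_module (s n - f)
        \<le> hnorm kernel_module (s n - w n) + hnorm kernel_module (w n - f)"
      by (intro always_eventually allI completion.hnorm_diff_triangle wX s fX)
    show "(\<lambda>n. hnorm kernel_module (s n - w n) + hnorm kernel_module (w n - f)) \<longlonglongrightarrow> 0"
      using tendsto_add[OF null approximates_hconverges[OF f, unfolded hconverges_def]] by simp
  qed simp
  with fX that show thesis by blast
qed

lemma kernel_module_definite:
  assumes f: "f \<in> hcarrier kernel_module" and "hip kernel_module f f = 0"
  shows "f = 0"
proof -
  have "f i j = 0" for i j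
    using completion.cauchy_schwarz[OF span_subset[OF kernel_at_mem] f, of "(i, j)"] assms
    by (simp add: reproducing hnorm_def)
  then show ?thesis by (simp add: fun_eq_iff)
qed

lemma hscale_eq_act: "hscale kernel_module c f = hact kernel_module f (c *\<^sub>C 1)"
  by (simp add: mult_scaleC_right)

theorem hilbert_kernel_module: "hilbert_module kernel_module"
proof
  fix s :: "nat \<Rightarrow> 'i \<Rightarrow> 'j \<Rightarrow> 'a"
  assume "\<And>n. s n \<in> hcarrier kernel_module"
    "\<And>\<epsilon>. 0 < \<epsilon> \<Longrightarrow> \<exists>N. \<forall>m\<ge>N. \<forall>n\<ge>N. hnorm kernel_module (s m - s n) < \<epsilon>"
  then show "\<exists>x\<in>hcarrier kernel_module. (\<lambda>n. hnorm kernel_module (s n - x)) \<longlonglongrightarrow> 0"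
    using kernel_module_complete[of s] unfolding hcauchy_def hconverges_def by blast
next
  fix f c assume "f \<in> hcarrier kernel_module"
  then show "hscale kernel_module c f \<in> hcarrier kernel_module"
    unfolding hscale_eq_act by (rule completion.act_mem)
next
  fix f g c assume "f \<in> hcarrier kernel_module" "g \<in> hcarrier kernel_module"
  then show "hip kernel_module f (hscale kernel_module c g) = c *\<^sub>C hip kernel_module f g"
    unfolding hscale_eq_act by (simp only: completion.inner_act) (simp add: mult_scaleC_right)
qed (fact completion.zero_mem completion.add_mem completion.act_mem completion.inner_add
    completion.inner_act completion.inner_star[symmetric] completion.inner_positive
    kernel_module_definite |
    simp add: fun_eq_iff scaleC_add_right scaleC_add_left scaleC_scaleC scaleC_one_left
      distrib_left distrib_right mult.assoc mult_scaleC_left mult_scaleC_right)+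

lemma combination_kernel_at: "combination kernel_module kernel_at xs = kernel_span xs"
  by (induction xs) (simp_all add: fun_eq_iff kernel_at_def)

lemma total_kernel_at: "total_family kernel_module kernel_at"
  unfolding total_family_def
proof (intro conjI ballI allI impI)
  fix f and \<epsilon> :: real assume f: "f \<in> hcarrier kernel_module" and "0 < \<epsilon>"
  then obtain w where w: "approximates w f" by auto
  then obtain n where n: "hnorm kernel_module (w n - f) < \<epsilon>"
    using approximates_within[OF w \<open>0 < \<epsilon>\<close>] by blast
  obtain xs where xs: "w n = kernel_span xs" using approximatesD(1)[OF w] by blast
  have "hnorm kernel_module (f - combination kernel_module kernel_at xs) < \<epsilon>"
    unfolding combination_kernel_at using n f xs completion.hnorm_diff_commute[OF f span_subset, of "w n"] by simp
  then show "\<exists>xs. hnorm kernel_module (f - combination kernel_module kernel_at xs) < \<epsilon>" by blast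
qed (rule span_subset[OF kernel_at_mem])

text \<open>
  A bounded operator of the span that is given by a formula continuous for pointwise convergence
  is extended to the completion by the same formula.
\<close>

lemma approximates_image:
  assumes w: "approximates w f"
    and span: "\<And>xs. \<Phi> (kernel_span xs) \<in> range kernel_span"
    and diff: "\<And>f g. \<Phi> (f - g) = \<Phi> f - \<Phi> g"
    and bound: "\<And>f. f \<in> range kernel_span \<Longrightarrow> hnorm span_module (\<Phi> f) \<le> C * hnorm span_module f"
    and lim: "\<And>i j. (\<lambda>n. \<Phi> (w n) i j) \<longlonglongrightarrow> \<Phi> f i j"
  shows "approximates (\<lambda>n. \<Phi> (w n)) (\<Phi> f)"
proof -
  note wD = approximatesD[OF w]
  have "hcauchy span_module (\<lambda>n. \<Phi> (w n))"
  proof (rule span.hcauchy_dominated[OF wD(2) wD(2), of "max C 0"])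
    fix m n
    have "hnorm span_module (\<Phi> (w m) - \<Phi> (w n)) \<le> C * hnorm span_module (w m - w n)"
      unfolding diff[symmetric] using wD(1) by (intro bound span.diff_mem[simplified]) auto
    also have "\<dots> \<le> max C 0 * (hnorm span_module (w m - w n) + hnorm span_module (w m - w n))"
      by (intro mult_mono) auto
    finally show "hnorm span_module (\<Phi> (w m) - \<Phi> (w n))
      \<le> max C 0 * (hnorm span_module (w m - w n) + hnorm span_module (w m - w n))" .
  qed simp
  moreover have "\<Phi> (w n) \<in> range kernel_span" for n
    using span wD(1)[of n] by auto
  ultimately show ?thesis using lim by (simp add: approximates_def)
qed

end

section \<open>The kernel of a map on a twisted system\<close>

context twisted_system
begin

lemmas \<alpha>_simps = star_automorphism_simps[OF action_automorphism]

lemma \<alpha>_bij: "bij (\<alpha> g)"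
  using action_automorphism[of g] by (simp add: star_automorphism_def)

lemma \<alpha>_inv [simp]: "\<alpha> g (inv (\<alpha> g) a) = a" "inv (\<alpha> g) (\<alpha> g a) = a"
  using \<alpha>_bij[of g] by (simp_all add: bij_is_surj bij_is_inj surj_f_inv_f)

lemma \<alpha>_inject: "\<alpha> g a = \<alpha> g b \<longleftrightarrow> a = b"
  using \<alpha>_bij[of g] by (simp add: bij_is_inj inj_eq)

lemma \<sigma>_cancel [simp]:
  "star (\<sigma> g h) * \<sigma> g h = 1" "\<sigma> g h * star (\<sigma> g h) = 1"
  "star (\<sigma> g h) * (\<sigma> g h * a) = a" "\<sigma> g h * (star (\<sigma> g h) * a) = a"
  using cocycle_unitary[of g h] by (simp_all add: unitary_element_def mult.assoc[symmetric])

lemma \<alpha>_zero: "\<alpha> 0 a = a"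
  using twisted_action[of 0 0 a] by (simp add: cocycle_left_unit \<alpha>_inject)

text \<open>
  The value at \<open>a\<^sup>* b\<close> is the inner product of \<open>\<rho>(a) v(g) x\<close> and \<open>\<rho>(b) v(h) x\<close> if \<open>T = T\<^sub>\<rho>\<^sub>,\<^sub>v\<^sub>,\<^sub>x\<^sub>,\<^sub>x\<close>.
\<close>

definition twisted_kernel :: "('g \<Rightarrow> 'a \<Rightarrow> 'a) \<Rightarrow> 'g \<Rightarrow> 'g \<Rightarrow> 'a \<Rightarrow> 'a" where
  "twisted_kernel T g h c
    = \<alpha> g (T (- g + h) (inv (\<alpha> g) (c * star (\<sigma> g (- g + h))))) * \<sigma> g (- g + h)"

text \<open>
  The substitution \<open>h = g l\<close>, \<open>c = \<alpha>\<^sub>g(y) \<sigma>(g, l)\<close> removes all inverses from the formula; by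
  \<open>kernel_argument\<close> it is always possible.
\<close>

lemma twisted_kernel_eq: "twisted_kernel T g (g + l) (\<alpha> g y * \<sigma> g l) = \<alpha> g (T l y) * \<sigma> g l"
  by (simp add: twisted_kernel_def mult.assoc add.assoc[symmetric])

lemma kernel_argument:
  obtains l y where "h = g + l" "c = \<alpha> g y * \<sigma> g l"
proof
  show "h = g + (- g + h)" by (simp add: add.assoc[symmetric])
  show "c = \<alpha> g (inv (\<alpha> g) (c * star (\<sigma> g (- g + h)))) * \<sigma> g (- g + h)"
    by (simp add: mult.assoc)
qed

text \<open>
  Invariance of the kernel under \<open>v(h)\<close>: since \<open>v(h) \<rho>(a) v(g) x\<close> has to be
  \<open>(\<rho>(\<alpha>\<^sub>h(a) \<sigma>(h, g)) v(h g) x) \<cdot> \<sigma>(h, g)\<^sup>*\<close>, the kernel at translated points is a conjugate of the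
  image of the kernel under \<open>\<alpha>\<^sub>h\<close>. This is where the cocycle identity enters.
\<close>

lemma twisted_kernel_shift:
  "twisted_kernel T (h + g) (h + g') (star (\<sigma> h g) * \<alpha> h c * \<sigma> h g')
    = star (\<sigma> h g) * \<alpha> h (twisted_kernel T g g' c) * \<sigma> h g'"
proof -
  obtain l y where g': "g' = g + l" and c: "c = \<alpha> g y * \<sigma> g l" by (rule kernel_argument)
  have cocycle': "\<alpha> h (\<sigma> g l) * \<sigma> h (g + l) = \<sigma> h g * \<sigma> (h + g) l"
    by (simp add: cocycle)
  have key: "star (\<sigma> h g) * \<alpha> h (\<alpha> g z * \<sigma> g l) * \<sigma> h (g + l) = \<alpha> (h + g) z * \<sigma> (h + g) l" for z
    by (simp add: \<alpha>_simps twisted_action mult.assoc cocycle')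
  show ?thesis
    unfolding g' c by (simp only: key add.assoc[symmetric] twisted_kernel_eq)
qed

end

section \<open>The equivariant representation of a positive definite map\<close>

locale positive_definite_map = twisted_system \<alpha> \<sigma>
  for \<alpha> :: "'g::group_add \<Rightarrow> 'a::unital_cstar_algebra \<Rightarrow> 'a"
    and \<sigma> :: "'g \<Rightarrow> 'g \<Rightarrow> 'a" +
  fixes T :: "'g \<Rightarrow> 'a \<Rightarrow> 'a"
  assumes T_linear: "T \<in> L_maps"
    and T_positive: "positive_definite \<alpha> \<sigma> T"
begin

lemma T_simps: "T g (a + b) = T g a + T g b" "T g (c *\<^sub>C a) = c *\<^sub>C T g a"
proof -
  have "module_hom scaleC scaleC (T g)"
    using T_linear by (simp add: L_maps_def Vector_Spaces.linear_iff_module_hom)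
  then show "T g (a + b) = T g a + T g b" "T g (c *\<^sub>C a) = c *\<^sub>C T g a"
    by (simp_all add: module_hom.add module_hom.scale)
qed

definition kernel :: "'g \<Rightarrow> 'a \<Rightarrow> 'g \<Rightarrow> 'a \<Rightarrow> 'a" where
  "kernel g a h b = twisted_kernel T g h (star a * b)"

sublocale positive_kernel kernel
proof
  show "positive_matrix n (\<lambda>l m. kernel (p l) (q l) (p m) (q m))" for n p q
    using T_positive unfolding positive_definite_def kernel_def twisted_kernel_def by blast
qed

lemma twisted_kernel_add: "twisted_kernel T g h (a + b) = twisted_kernel T g h a + twisted_kernel T g h b"
  by (simp add: twisted_kernel_def distrib_right \<alpha>_simps T_simps
      star_automorphism_simps[OF star_automorphism_inv[OF action_automorphism]])

lemma twisted_kernel_scaleC: "twisted_kernel T g h (c *\<^sub>C a) = c *\<^sub>C twisted_kernel T g h a"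
  by (simp add: twisted_kernel_def mult_scaleC_left \<alpha>_simps T_simps
      star_automorphism_simps[OF star_automorphism_inv[OF action_automorphism]])

lemma kernel_mult: "kernel g (star c * a) p q = kernel g a p (c * q)"
  by (simp add: kernel_def star_mult star_star mult.assoc)

lemma kernel_antilinear:
  "kernel g (a + b) p q = kernel g a p q + kernel g b p q"
  "kernel g (c *\<^sub>C a) p q = cnj c *\<^sub>C kernel g a p q"
  by (simp_all add: kernel_def star_add star_scaleC distrib_right mult_scaleC_left
      twisted_kernel_add twisted_kernel_scaleC)

text \<open>
  The operators \<open>\<rho>(c)\<close>, \<open>v(h)\<close> and \<open>v(h)\<^sup>-\<^sup>1\<close> on functions \<open>f(g, a) = \<langle>\<rho>(a) v(g) x, f\<rangle>\<close>. The first
  formula is \<open>\<langle>e, \<rho>(c) f\<rangle> = \<langle>\<rho>(c\<^sup>*) e, f\<rangle>\<close>. The second comes from \<open>\<langle>v(h) e, v(h) f\<rangle> = \<alpha>\<^sub>h(\<langle>e, f\<rangle>)\<close>,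
  solved for the value at an arbitrary point; \<open>translate_shift\<close> is its readable form.
\<close>

definition left_mult :: "'a \<Rightarrow> ('g \<Rightarrow> 'a \<Rightarrow> 'a) \<Rightarrow> 'g \<Rightarrow> 'a \<Rightarrow> 'a" where
  "left_mult c f = (\<lambda>g a. f g (star c * a))"

definition translate :: "'g \<Rightarrow> ('g \<Rightarrow> 'a \<Rightarrow> 'a) \<Rightarrow> 'g \<Rightarrow> 'a \<Rightarrow> 'a" where
  "translate h f = (\<lambda>g a. star (\<sigma> h (- h + g)) *
     \<alpha> h (f (- h + g) (inv (\<alpha> h) (a * star (\<sigma> h (- h + g))))))"

definition untranslate :: "'g \<Rightarrow> ('g \<Rightarrow> 'a \<Rightarrow> 'a) \<Rightarrow> 'g \<Rightarrow> 'a \<Rightarrow> 'a" where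
  "untranslate h f = (\<lambda>g a. inv (\<alpha> h) (\<sigma> h g * f (h + g) (\<alpha> h a * \<sigma> h g)))"

lemma translate_shift: "translate h f (h + g) (\<alpha> h a * \<sigma> h g) = star (\<sigma> h g) * \<alpha> h (f g a)"
  by (simp add: translate_def mult.assoc add.assoc[symmetric])

lemma shift_ext:
  assumes "\<And>g a. F (h + g) (\<alpha> h a * \<sigma> h g) = F' (h + g) (\<alpha> h a * \<sigma> h g)"
  shows "F = F'"
proof (intro ext)
  fix g a
  obtain l y where "g = h + l" "a = \<alpha> h y * \<sigma> h l" by (rule kernel_argument)
  then show "F g a = F' g a" using assms by simp
qed

lemma untranslate_translate [simp]: "untranslate h (translate h f) = f"
  by (simp add: untranslate_def translate_shift)

lemma translate_untranslate [simp]: "translate h (untranslate h f) = f"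
  by (rule shift_ext[of _ h]) (simp add: translate_shift, simp add: untranslate_def)

lemma left_mult_diff: "left_mult c (f - f') = left_mult c f - left_mult c f'"
  by (simp add: left_mult_def fun_eq_iff)

lemma translate_add: "translate h (f + f') = translate h f + translate h f'"
  by (simp add: translate_def fun_eq_iff \<alpha>_simps distrib_left)

lemma translate_diff: "translate h (f - f') = translate h f - translate h f'"
  by (simp add: translate_def fun_eq_iff \<alpha>_simps right_diff_distrib)

lemma untranslate_diff: "untranslate h (f - f') = untranslate h f - untranslate h f'"
proof -
  have "translate h (untranslate h f - untranslate h f') = f - f'"
    by (simp add: translate_diff)
  then show ?thesis by (metis untranslate_translate)
qed

lemma left_mult_kernel_span:
  "left_mult c (kernel_span xs) = kernel_span (map (\<lambda>((p, q), b). ((p, c * q), b)) xs)"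
proof -
  have "kernel_span xs g (star c * a) = kernel_span (map (\<lambda>((p, q), b). ((p, c * q), b)) xs) g a" for g a
    by (induction xs) (auto simp: kernel_mult)
  then show ?thesis by (simp add: left_mult_def fun_eq_iff)
qed

lemma translate_kernel_span:
  "translate h (kernel_span xs)
    = kernel_span (map (\<lambda>((p, q), b). ((h + p, \<alpha> h q * \<sigma> h p), star (\<sigma> h p) * \<alpha> h b)) xs)"
    (is "_ = kernel_span (map ?m xs)")
proof (rule shift_ext[of _ h])
  fix g a
  have K: "kernel (h + g) (\<alpha> h a * \<sigma> h g) (h + p) (\<alpha> h q * \<sigma> h p) * (star (\<sigma> h p) * \<alpha> h b)
      = star (\<sigma> h g) * \<alpha> h (kernel g a p q * b)" for p q b
  proof -
    have "star (\<alpha> h a * \<sigma> h g) * (\<alpha> h q * \<sigma> h p) = star (\<sigma> h g) * \<alpha> h (star a * q) * \<sigma> h p"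
      by (simp add: star_mult \<alpha>_simps mult.assoc)
    then show ?thesis
      by (simp only: kernel_def twisted_kernel_shift) (simp add: \<alpha>_simps mult.assoc)
  qed
  have "star (\<sigma> h g) * \<alpha> h (kernel_span xs g a) = kernel_span (map ?m xs) (h + g) (\<alpha> h a * \<sigma> h g)"
    by (induction xs) (auto simp: K distrib_left \<alpha>_simps(4,6))
  then show "translate h (kernel_span xs) (h + g) (\<alpha> h a * \<sigma> h g)
    = kernel_span (map ?m xs) (h + g) (\<alpha> h a * \<sigma> h g)"
    by (simp add: translate_shift)
qed

text \<open>
  The span is mapped onto itself by translation: solve for the points and coefficients of the
  preimage.
\<close>

lemma untranslate_kernel_span: "untranslate h (kernel_span xs) \<in> range kernel_span"
proof -
  define ys where "ys = map (\<lambda>((p, q), b). ((- h + p, inv (\<alpha> h) (q * star (\<sigma> h (- h + p)))),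
    inv (\<alpha> h) (\<sigma> h (- h + p) * b))) xs"
  have "map (\<lambda>((p, q), b). ((h + p, \<alpha> h q * \<sigma> h p), star (\<sigma> h p) * \<alpha> h b)) ys = xs"
    by (simp add: ys_def comp_def split_beta mult.assoc add.assoc[symmetric])
  then have "translate h (kernel_span ys) = kernel_span xs" by (simp add: translate_kernel_span)
  then show ?thesis by (metis untranslate_translate rangeI)
qed

lemma inner_left_mult:
  assumes "f \<in> range kernel_span" "f' \<in> range kernel_span"
  shows "hip span_module (left_mult c f) f' = hip span_module f (left_mult (star c) f')"
proof -
  obtain xs ys where xs: "f = kernel_span xs" "f' = kernel_span ys" using assms by blast
  have "pairing (map (\<lambda>((p, q), b). ((p, c * q), b)) xs) f' = pairing xs (left_mult (star c) f')"
    by (induction xs) (auto simp: left_mult_def star_star)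
  then show ?thesis by (simp add: xs left_mult_kernel_span inner_kernel_span)
qed

lemma inner_translate:
  assumes "f \<in> range kernel_span" "f' \<in> range kernel_span"
  shows "hip span_module (translate h f) (translate h f') = \<alpha> h (hip span_module f f')"
proof -
  obtain xs ys where xs: "f = kernel_span xs" "f' = kernel_span ys" using assms by blast
  have "pairing (map (\<lambda>((p, q), b). ((h + p, \<alpha> h q * \<sigma> h p), star (\<sigma> h p) * \<alpha> h b)) xs) (translate h f')
      = \<alpha> h (pairing xs f')"
    by (induction xs) (auto simp: translate_shift \<alpha>_simps star_mult star_star mult.assoc)
  then show ?thesis using assms by (simp add: xs translate_kernel_span inner_kernel_span)
qed

lemma hnorm_translate:
  "f \<in> range kernel_span \<Longrightarrow> hnorm span_module (translate h f) = hnorm span_module f"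
  by (simp add: hnorm_def inner_translate star_automorphism_norm[OF action_automorphism])

lemma hnorm_untranslate:
  "f \<in> range kernel_span \<Longrightarrow> hnorm span_module (untranslate h f) = hnorm span_module f"
  using hnorm_translate[of "untranslate h f" h] untranslate_kernel_span by auto

lemma kernel_span_antilinear:
  "kernel_span xs g (a + b) = kernel_span xs g a + kernel_span xs g b"
  "kernel_span xs g (c *\<^sub>C a) = cnj c *\<^sub>C kernel_span xs g a"
  by (induction xs)
    (simp_all add: kernel_antilinear distrib_right mult_scaleC_left scaleC_add_right
      linear_0[OF bounded_linear.linear[OF bounded_linear_scaleC]])

text \<open>
  Write \<open>\<parallel>c\<parallel>\<^sup>2 - c\<^sup>* c = d\<^sup>* d\<close>. Then \<open>\<parallel>c\<parallel>\<^sup>2 \<langle>f, f\<rangle> - \<langle>\<rho>(c) f, \<rho>(c) f\<rangle> = \<langle>\<rho>(d) f, \<rho>(d) f\<rangle> \<ge> 0\<close>.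
\<close>

lemma hnorm_left_mult:
  assumes f: "f \<in> range kernel_span"
  shows "hnorm span_module (left_mult c f) \<le> norm c * hnorm span_module f"
proof -
  define N where "N = norm (star c * c)"
  have mem: "left_mult d f \<in> range kernel_span" for d
    using f by (auto simp: left_mult_kernel_span)
  have inner: "hip span_module (left_mult d f) (left_mult d f)
      = hip span_module f (left_mult (star d * d) f)" for d
  proof -
    have "left_mult (star d) (left_mult d f) = left_mult (star d * d) f"
      by (simp add: left_mult_def star_mult star_star mult.assoc)
    then show ?thesis using inner_left_mult[OF f mem] by simp
  qed
  obtain d where d: "N *\<^sub>R 1 - star c * c = star d * d"
    using positive_norm_diff[OF positive_star_mult[of c]] unfolding N_def positive_element_def by blast
  have "left_mult (star d * d) f = hact span_module f (N *\<^sub>R 1) - left_mult (star c * c) f"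
  proof -
    obtain xs where xs: "f = kernel_span xs" using f by blast
    have eq: "star (star d * d) * a = complex_of_real N *\<^sub>C a + (- 1) *\<^sub>C (star (star c * c) * a)" for a
      unfolding d[symmetric]
      by (simp add: star_diff star_mult star_star star_scaleR scaleR_scaleC[symmetric] left_diff_distrib
          scaleC_minus_left scaleC_one_left)
    show ?thesis
      unfolding fun_eq_iff left_mult_def eq xs kernel_span_antilinear
      by (simp add: scaleR_scaleC[symmetric] scaleC_minus_left scaleC_one_left)
  qed
  then have "hip span_module (left_mult d f) (left_mult d f)
      = hip span_module f (hact span_module f (N *\<^sub>R 1)) - hip span_module f (left_mult (star c * c) f)"
    unfolding inner using span.inner_diff[of f "hact span_module f (N *\<^sub>R 1)" "left_mult (star c * c) f"]
      f mem span.act_mem[of f] by simp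
  also have "\<dots> = N *\<^sub>R hip span_module f f - hip span_module (left_mult c f) (left_mult c f)"
    using f by (simp add: span.inner_act inner)
  finally have "positive_element
      (N *\<^sub>R hip span_module f f - hip span_module (left_mult c f) (left_mult c f))"
    using span.inner_positive[of "left_mult d f"] mem by simp
  then have "norm (hip span_module (left_mult c f) (left_mult c f)) \<le> norm (N *\<^sub>R hip span_module f f)"
    by (rule positive_norm_mono[OF span.inner_positive, rotated]) (simp add: mem)
  then have "(hnorm span_module (left_mult c f))\<^sup>2 \<le> (norm c * hnorm span_module f)\<^sup>2"
    by (simp add: hnorm_square N_def cstar_identity power_mult_distrib)
  then show ?thesis by (rule power2_le_imp_le) simp
qed

lemma approximates_left_mult:
  assumes "approximates w f"
  shows "approximates (\<lambda>n. left_mult c (w n)) (left_mult c f)"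
  using assms
proof (rule approximates_image)
  show "(\<lambda>n. left_mult c (w n) g a) \<longlonglongrightarrow> left_mult c f g a" for g a
    unfolding left_mult_def by (rule approximatesD[OF assms])
  show "left_mult c (f - f') = left_mult c f - left_mult c f'" for f f'
    by (rule left_mult_diff)
qed (auto simp: left_mult_kernel_span intro: hnorm_left_mult)

lemma approximates_translate:
  assumes "approximates w f"
  shows "approximates (\<lambda>n. translate h (w n)) (translate h f)"
  using assms
proof (rule approximates_image)
  show "(\<lambda>n. translate h (w n) g a) \<longlonglongrightarrow> translate h f g a" for g a
    unfolding translate_def
    by (intro tendsto_mult_left approximatesD[OF assms]
        bounded_linear.tendsto[OF star_automorphism_bounded_linear[OF action_automorphism]])
  show "hnorm span_module (translate h f) \<le> 1 * hnorm span_module f" if "f \<in> range kernel_span" for f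
    using that by (simp add: hnorm_translate)
  show "translate h (f - f') = translate h f - translate h f'" for f f'
    by (rule translate_diff)
qed (auto simp: translate_kernel_span)

lemma approximates_untranslate:
  assumes "approximates w f"
  shows "approximates (\<lambda>n. untranslate h (w n)) (untranslate h f)"
  using assms
proof (rule approximates_image)
  show "(\<lambda>n. untranslate h (w n) g a) \<longlonglongrightarrow> untranslate h f g a" for g a
    unfolding untranslate_def
    by (intro tendsto_mult_left approximatesD[OF assms] bounded_linear.tendsto[OF
        star_automorphism_bounded_linear[OF star_automorphism_inv[OF action_automorphism]]])
  show "hnorm span_module (untranslate h f) \<le> 1 * hnorm span_module f" if "f \<in> range kernel_span" for f
    using that by (simp add: hnorm_untranslate)
  show "untranslate h (f - f') = untranslate h f - untranslate h f'" for f f'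
    by (rule untranslate_diff)
qed (auto simp: untranslate_kernel_span)

lemma left_mult_mem: "f \<in> hcarrier kernel_module \<Longrightarrow> left_mult c f \<in> hcarrier kernel_module"
  using approximates_left_mult by fastforce

lemma translate_mem: "f \<in> hcarrier kernel_module \<Longrightarrow> translate h f \<in> hcarrier kernel_module"
  using approximates_translate by fastforce

lemma untranslate_mem: "f \<in> hcarrier kernel_module \<Longrightarrow> untranslate h f \<in> hcarrier kernel_module"
  using approximates_untranslate by fastforce

lemma left_mult_adjoint:
  assumes "f \<in> hcarrier kernel_module" "f' \<in> hcarrier kernel_module"
  shows "hip kernel_module (left_mult c f) f' = hip kernel_module f (left_mult (star c) f')"
proof -
  obtain w u where w: "approximates w f" and u: "approximates u f'" using assms by auto
  show ?thesis
    using LIMSEQ_unique[OF tendsto_inner[OF approximates_left_mult[OF w] u]]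
      tendsto_inner[OF w approximates_left_mult[OF u]]
    by (simp add: inner_left_mult approximatesD(1)[OF w] approximatesD(1)[OF u])
qed

lemma translate_isometric:
  assumes "f \<in> hcarrier kernel_module" "f' \<in> hcarrier kernel_module"
  shows "hip kernel_module (translate h f) (translate h f') = \<alpha> h (hip kernel_module f f')"
proof -
  obtain w u where w: "approximates w f" and u: "approximates u f'" using assms by auto
  show ?thesis
    using LIMSEQ_unique[OF tendsto_inner[OF approximates_translate[OF w] approximates_translate[OF u]]]
      bounded_linear.tendsto[OF star_automorphism_bounded_linear[OF action_automorphism]
        tendsto_inner[OF w u]]
    by (simp add: inner_translate approximatesD(1)[OF w] approximatesD(1)[OF u])
qed

text \<open>
  The kernel is antilinear in its left argument from \<open>A\<close>, and pointwise limits preserve this. For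
  the operators it means that \<open>\<rho>(c)\<close> is linear in \<open>c\<close>.
\<close>

lemma kernel_module_antilinear:
  assumes "f \<in> hcarrier kernel_module"
  shows "f g (a + b) = f g a + f g b" "f g (c *\<^sub>C a) = cnj c *\<^sub>C f g a"
proof -
  obtain w where w: "approximates w f" using assms by auto
  have w_eq: "w n g (a + b) = w n g a + w n g b" "w n g (c *\<^sub>C a) = cnj c *\<^sub>C w n g a" for n
    using approximatesD(1)[OF w, of n] kernel_span_antilinear by auto
  show "f g (a + b) = f g a + f g b"
    using LIMSEQ_unique[OF approximatesD(3)[OF w]]
      tendsto_add[OF approximatesD(3)[OF w] approximatesD(3)[OF w]] by (simp add: w_eq)
  show "f g (c *\<^sub>C a) = cnj c *\<^sub>C f g a"
    using LIMSEQ_unique[OF approximatesD(3)[OF w]]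
      bounded_linear.tendsto[OF bounded_linear_scaleC approximatesD(3)[OF w]] by (simp add: w_eq)
qed

lemma left_mult_covariant: "left_mult (\<alpha> h c) (translate h f) = translate h (left_mult c f)"
proof (rule shift_ext[of _ h])
  fix g a
  have "star (\<alpha> h c) * (\<alpha> h a * \<sigma> h g) = \<alpha> h (star c * a) * \<sigma> h g"
    by (simp add: \<alpha>_simps mult.assoc)
  then show "left_mult (\<alpha> h c) (translate h f) (h + g) (\<alpha> h a * \<sigma> h g)
    = translate h (left_mult c f) (h + g) (\<alpha> h a * \<sigma> h g)"
    by (simp only: left_mult_def translate_shift)
qed

text \<open>
  Compare values at the translates by \<open>g\<close> of translates by \<open>h\<close>, which exhaust all points. The cocycle identity
  rewrites such a point as \<open>\<sigma>(g, h)\<close> times a translate by \<open>g h\<close>.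
\<close>

lemma translate_translate:
  "translate g (translate h f)
    = hact kernel_module (left_mult (\<sigma> g h) (translate (g + h) f)) (star (\<sigma> g h))"
proof (rule shift_ext[of _ g])
  fix k' a'
  obtain k a where k': "k' = h + k" and a': "a' = \<alpha> h a * \<sigma> h k" by (rule kernel_argument)
  have cocycle': "\<alpha> g (\<sigma> h k) * \<sigma> g (h + k) = \<sigma> g h * \<sigma> (g + h) k"
    by (simp add: cocycle)
  have point: "\<alpha> g a' * \<sigma> g k' = \<sigma> g h * (\<alpha> (g + h) a * \<sigma> (g + h) k)"
    by (simp add: a' k' \<alpha>_simps twisted_action mult.assoc cocycle')
  have "star (\<sigma> g (h + k)) * star (\<alpha> g (\<sigma> h k)) = star (\<sigma> (g + h) k) * star (\<sigma> g h)"
    using arg_cong[OF cocycle', of star] by (simp add: star_mult)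
  then have "star (\<sigma> g (h + k)) * (star (\<alpha> g (\<sigma> h k)) * x) = star (\<sigma> (g + h) k) * (star (\<sigma> g h) * x)" for x
    by (simp add: mult.assoc[symmetric])
  then have "translate g (translate h f) (g + k') (\<alpha> g a' * \<sigma> g k')
      = star (\<sigma> (g + h) k) * \<alpha> (g + h) (f k a) * star (\<sigma> g h)"
    unfolding translate_shift k' a' by (simp add: \<alpha>_simps twisted_action mult.assoc)
  moreover have "hact kernel_module (left_mult (\<sigma> g h) (translate (g + h) f)) (star (\<sigma> g h))
      (g + k') (\<alpha> g a' * \<sigma> g k')
    = star (\<sigma> (g + h) k) * \<alpha> (g + h) (f k a) * star (\<sigma> g h)"
    unfolding k' point[unfolded k'] left_mult_def
    by (simp add: add.assoc[symmetric]) (simp only: translate_shift mult.assoc)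
  ultimately show "translate g (translate h f) (g + k') (\<alpha> g a' * \<sigma> g k')
    = hact kernel_module (left_mult (\<sigma> g h) (translate (g + h) f)) (star (\<sigma> g h))
      (g + k') (\<alpha> g a' * \<sigma> g k')"
    by simp
qed

lemma bij_betw_translate: "bij_betw (translate h) (hcarrier kernel_module) (hcarrier kernel_module)"
  by (rule bij_betw_byWitness[where f' = "untranslate h"])
    (auto simp del: kernel_module_simps simp: translate_mem untranslate_mem)

lemma inv_into_translate:
  "f \<in> hcarrier kernel_module \<Longrightarrow> inv_into (hcarrier kernel_module) (translate h) f = untranslate h f"
  by (rule inv_into_f_eq) (auto simp del: kernel_module_simps
      simp: bij_betw_imp_inj_on[OF bij_betw_translate] untranslate_mem)

lemma hnorm_translate_kernel_module:
  "f \<in> hcarrier kernel_module \<Longrightarrow> hnorm kernel_module (translate h f) = hnorm kernel_module f"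
  unfolding hnorm_def translate_isometric star_automorphism_norm[OF action_automorphism] by simp

theorem equivariant_rep_kernel_module: "equivariant_rep \<alpha> \<sigma> kernel_module left_mult translate"
proof (intro equivariant_rep.intro twisted_system_axioms hilbert_kernel_module
    equivariant_rep_axioms.intro)
  fix a b c g h and f f' :: "'g \<Rightarrow> 'a \<Rightarrow> 'a"
  show "is_adjoint kernel_module kernel_module (left_mult a) (left_mult (star a))"
    unfolding is_adjoint_def using left_mult_mem left_mult_adjoint by blast
  show "invertible_bounded kernel_module (translate g)"
    unfolding invertible_bounded_def
  proof (intro conjI bij_betw_translate ballI allI exI)
    show "translate g (hscale kernel_module c f) = hscale kernel_module c (translate g f)" for c f
      by (simp add: translate_def \<alpha>_simps mult_scaleC_right)
    show "hnorm kernel_module (translate g f) \<le> 1 * hnorm kernel_module f"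
      if "f \<in> hcarrier kernel_module" for f
      using hnorm_translate_kernel_module[OF that] by simp
  qed (rule translate_add)
  assume f: "f \<in> hcarrier kernel_module"
  show "left_mult (a + b) f = left_mult a f + left_mult b f"
    using kernel_module_antilinear[OF f] by (simp add: left_mult_def fun_eq_iff star_add distrib_right)
  show "left_mult (c *\<^sub>C a) f = hscale kernel_module c (left_mult a f)"
    using kernel_module_antilinear[OF f] by (simp add: left_mult_def fun_eq_iff star_scaleC mult_scaleC_left)
  show "left_mult (a * b) f = left_mult a (left_mult b f)" "left_mult 1 f = f"
    by (simp_all add: left_mult_def star_mult mult.assoc)
  show "left_mult (\<alpha> g a) f
      = translate g (left_mult a (inv_into (hcarrier kernel_module) (translate g) f))"
    by (simp only: inv_into_translate[OF f] left_mult_covariant[symmetric] translate_untranslate)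
  show "translate g (translate h f)
      = hact kernel_module (left_mult (\<sigma> g h) (translate (g + h) f)) (star (\<sigma> g h))"
    by (rule translate_translate)
  show "translate g (hact kernel_module f a) = hact kernel_module (translate g f) (\<alpha> g a)"
    by (simp add: translate_def \<alpha>_simps mult.assoc)
  assume "f' \<in> hcarrier kernel_module"
  with f show "\<alpha> g (hip kernel_module f f') = hip kernel_module (translate g f) (translate g f')"
    by (rule translate_isometric[symmetric])
qed

text \<open>
  With \<open>x = K(\<cdot>, (e, 1))\<close> the vectors \<open>\<rho>(a) v(g) x\<close> are exactly the kernel functions. Hence \<open>x\<close> is
  cyclic, and evaluating them at \<open>(e, 1)\<close> returns \<open>T\<close>.
\<close>

lemma orbit_kernel_at: "left_mult a (translate g (kernel_at (0, 1))) = kernel_at (g, a)"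
  unfolding kernel_at_eq translate_kernel_span left_mult_kernel_span
  by (simp add: cocycle_right_unit translate_kernel_span left_mult_kernel_span \<alpha>_simps)

lemma coefficient_kernel_at:
  "T = coefficient kernel_module left_mult translate (kernel_at (0, 1)) (kernel_at (0, 1))"
proof (intro ext)
  fix g a
  have "kernel_at (g, a) 0 1 = T g a"
    using \<alpha>_zero by (simp add: kernel_at_def kernel_def twisted_kernel_def cocycle_left_unit)
      (metis \<alpha>_inv(1))
  then show "T g a = coefficient kernel_module left_mult translate (kernel_at (0, 1)) (kernel_at (0, 1)) g a"
    by (simp add: coefficient_def orbit_kernel_at reproducing[OF span_subset[OF kernel_at_mem]])
qed

end

section \<open>Cyclic vectors and uniqueness\<close>

text \<open>
  Complex multiples are absorbed into the coefficients from \<open>A\<close>.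
\<close>

lemma (in hilbert_module) hspan_eq_combinations:
  assumes mem: "\<And>i. e i \<in> hcarrier X"
  shows "hspan X {hact X (e i) b | i b. True} = range (combination X e)"
proof (intro equalityI subsetI)
  fix z assume "z \<in> hspan X {hact X (e i) b | i b. True}"
  then obtain n :: nat and c s where z: "z = (\<Sum>l<n. hscale X (c l) (s l))"
    and s: "\<forall>l<n. \<exists>i b. s l = hact X (e i) b"
    unfolding hspan_def by auto
  then obtain p b where s: "\<And>l. l < n \<Longrightarrow> s l = hact X (e (p l)) (b l)" by metis
  have "z = combination X e (map (\<lambda>l. (p l, c l *\<^sub>C b l)) [0..<n])"
    unfolding z combination_def
    by (simp add: sum_list_sum_nth atLeast0LessThan s act_scale_right mem)
  then show "z \<in> range (combination X e)" by blast
next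
  fix z assume "z \<in> range (combination X e)"
  then obtain xs where z: "z = combination X e xs" by blast
  have "z = (\<Sum>l<length xs. hscale X 1 (hact X (e (fst (xs ! l))) (snd (xs ! l))))"
    by (simp add: z combination_def sum_list_sum_nth atLeast0LessThan split_beta scale_one mem act_closed)
  then show "z \<in> hspan X {hact X (e i) b | i b. True}"
    unfolding hspan_def mem_Collect_eq
    by (intro exI[of _ "length xs"] exI[of _ "\<lambda>_. 1"]
        exI[of _ "\<lambda>l. hact X (e (fst (xs ! l))) (snd (xs ! l))"]) auto
qed

context equivariant_rep
begin

definition orbit :: "'x \<Rightarrow> 'g \<times> 'a \<Rightarrow> 'x" where
  "orbit x = (\<lambda>(g, a). \<rho> a (v g x))"

lemma rho_mem: "x \<in> hcarrier X \<Longrightarrow> \<rho> a x \<in> hcarrier X"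
  using rho_star[of a] by (auto simp: is_adjoint_def)

lemma rho_adjoint: "x \<in> hcarrier X \<Longrightarrow> y \<in> hcarrier X \<Longrightarrow> hip X (\<rho> a x) y = hip X x (\<rho> (star a) y)"
  using rho_star[of a] by (auto simp: is_adjoint_def)

lemma v_bij: "bij_betw (v g) (hcarrier X) (hcarrier X)"
  using v_invertible[of g] by (simp add: invertible_bounded_def)

lemma v_mem: "x \<in> hcarrier X \<Longrightarrow> v g x \<in> hcarrier X"
  using v_bij[of g] by (auto simp: bij_betw_def)

lemma rho_v: "x \<in> hcarrier X \<Longrightarrow> \<rho> (\<alpha> g a) (v g x) = v g (\<rho> a x)"
  using rho_covariant[OF v_mem[of x g]] bij_betw_inv_into_left[OF v_bij[of g]] by simp

lemma v_zero:
  assumes x: "x \<in> hcarrier X"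
  shows "v 0 x = x"
proof -
  have "v 0 (v 0 x) = v 0 x"
    using v_twisted[OF x, of 0 0] by (simp add: cocycle_left_unit rho_one act_one v_mem x)
  then show ?thesis
    using bij_betw_imp_inj_on[OF v_bij[of 0]] by (simp add: inj_on_eq_iff v_mem x)
qed

lemma orbit_mem: "x \<in> hcarrier X \<Longrightarrow> orbit x i \<in> hcarrier X"
  by (simp add: orbit_def split_beta rho_mem v_mem)

lemma orbit_unit: "x \<in> hcarrier X \<Longrightarrow> orbit x (0, 1) = x"
  by (simp add: orbit_def v_zero rho_one)

lemma cyclic_iff_total:
  assumes x: "x \<in> hcarrier X"
  shows "cyclic X \<rho> v x \<longleftrightarrow> total_family X (orbit x)"
proof -
  have "{hact X (\<rho> a (v g x)) b | a b g. True} = {hact X (orbit x i) b | i b. True}"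
    by (auto simp: orbit_def)
  then have "cyclic X \<rho> v x \<longleftrightarrow> hdense X (range (combination X (orbit x)))"
    unfolding cyclic_def using hspan_eq_combinations[of "orbit x"] orbit_mem[OF x] by simp
  then show ?thesis
    unfolding hdense_def total_family_def using orbit_mem[OF x] by simp
qed

lemma inner_rho_orbit:
  assumes "x \<in> hcarrier X" "y \<in> hcarrier X"
  shows "hip X (orbit x (g, b)) (\<rho> a y) = hip X (orbit x (g, star a * b)) y"
proof -
  have "orbit x (g, star a * b) = \<rho> (star a) (orbit x (g, b))"
    by (simp add: orbit_def rho_mult v_mem assms)
  then show ?thesis using rho_adjoint[OF orbit_mem[OF assms(1)] assms(2), of "star a"] by (simp add: star_star)
qed

lemma inner_rho_act:
  assumes "x \<in> hcarrier X" "y \<in> hcarrier X"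
  shows "hip X y (\<rho> a (hact X x b)) = hip X y (\<rho> a x) * b"
  using rho_adjoint[of y "hact X x b" "star a"] rho_adjoint[of y x "star a"] assms
  by (simp add: star_star ip_act rho_mem act_closed)

text \<open>
  The inner products of \<open>v(h) y\<close> with the orbit depend only on those of \<open>y\<close>. The points of the form
  \<open>(h g, \<alpha>\<^sub>h(b) \<sigma>(h, g))\<close> are all points, by \<open>kernel_argument\<close>.
\<close>

lemma inner_v_orbit:
  assumes x: "x \<in> hcarrier X" and y: "y \<in> hcarrier X"
  shows "hip X (orbit x (h + g, \<alpha> h b * \<sigma> h g)) (v h y) = star (\<sigma> h g) * \<alpha> h (hip X (orbit x (g, b)) y)"
proof -
  let ?w = "\<rho> (\<sigma> h g) (v (h + g) x)"
  have w: "?w \<in> hcarrier X" by (intro rho_mem v_mem x)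
  have "\<alpha> h (hip X (orbit x (g, b)) y) = hip X (v h (orbit x (g, b))) (v h y)"
    by (rule v_ip) (use x y orbit_mem in auto)
  also have "v h (orbit x (g, b)) = \<rho> (\<alpha> h b) (v h (v g x))"
    by (simp add: orbit_def rho_v v_mem x)
  also have "v h (v g x) = hact X ?w (star (\<sigma> h g))" by (rule v_twisted[OF x])
  also have "hip X (\<rho> (\<alpha> h b) (hact X ?w (star (\<sigma> h g)))) (v h y)
      = star (hip X (v h y) (\<rho> (\<alpha> h b) (hact X ?w (star (\<sigma> h g)))))"
    by (intro ip_star v_mem rho_mem act_closed x y)
  also have "\<dots> = \<sigma> h g * star (hip X (v h y) (\<rho> (\<alpha> h b) ?w))"
    using inner_rho_act[OF w v_mem[OF y]] by (simp add: star_mult star_star)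
  also have "star (hip X (v h y) (\<rho> (\<alpha> h b) ?w)) = hip X (\<rho> (\<alpha> h b) ?w) (v h y)"
    by (intro ip_star[symmetric] v_mem rho_mem x y)
  also have "\<rho> (\<alpha> h b) ?w = orbit x (h + g, \<alpha> h b * \<sigma> h g)"
    by (simp add: orbit_def rho_mult v_mem x)
  finally show ?thesis by simp
qed

text \<open>
  Move \<open>\<rho>(a)\<close> to the right, write \<open>v(h) x\<close> through \<open>v(g) v(g\<^sup>-\<^sup>1 h) x\<close>, and take \<open>v(g)\<close> out of both
  sides of the inner product as \<open>\<alpha>\<^sub>g\<close>.
\<close>

lemma inner_orbit:
  assumes x: "x \<in> hcarrier X"
  shows "hip X (orbit x (g, a)) (orbit x (h, b))
    = twisted_kernel (coefficient X \<rho> v x x) g h (star a * b)"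
proof -
  obtain l y where h: "h = g + l" and c: "star a * b = \<alpha> g y * \<sigma> g l" by (rule kernel_argument)
  let ?w = "\<rho> (\<sigma> g l) (v (g + l) x)"
  have w: "?w \<in> hcarrier X" by (intro rho_mem v_mem x)
  have "v g (v l x) = hact X ?w (star (\<sigma> g l))" by (rule v_twisted[OF x])
  then have w_eq: "?w = hact X (v g (v l x)) (\<sigma> g l)"
    by (simp add: act_act act_one w)
  have "hip X (orbit x (g, a)) (orbit x (h, b)) = hip X (v g x) (\<rho> (star a * b) (v h x))"
    by (simp add: orbit_def rho_adjoint rho_mult v_mem rho_mem x)
  also have "\<dots> = hip X (v g x) (\<rho> (\<alpha> g y) ?w)"
    by (simp add: h c rho_mult v_mem x)
  also have "\<dots> = hip X (v g x) (\<rho> (\<alpha> g y) (v g (v l x))) * \<sigma> g l"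
    unfolding w_eq by (intro inner_rho_act v_mem x)
  also have "\<dots> = \<alpha> g (coefficient X \<rho> v x x l y) * \<sigma> g l"
    by (simp add: coefficient_def rho_v v_mem v_ip rho_mem x)
  also have "\<dots> = twisted_kernel (coefficient X \<rho> v x x) g h (star a * b)"
    by (simp add: h c twisted_kernel_eq)
  finally show ?thesis .
qed

end

text \<open>
  The unitary preserves inner products with the orbits of \<open>x\<close> and \<open>x'\<close>. Both sides of each
  intertwining relation have the same inner products with the orbit of \<open>x'\<close>.
\<close>

theorem cyclic_unitarily_equivalent:
  fixes \<alpha> :: "'g::group_add \<Rightarrow> 'a::unital_cstar_algebra \<Rightarrow> 'a"
    and X :: "('x::ab_group_add, 'a) hmod"
    and X' :: "('y::ab_group_add, 'a) hmod"
  assumes "equivariant_rep \<alpha> \<sigma> X \<rho> v" "equivariant_rep \<alpha> \<sigma> X' \<rho>' v'"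
    and x: "x \<in> hcarrier X" and x': "x' \<in> hcarrier X'"
    and cyclic: "cyclic X \<rho> v x" "cyclic X' \<rho>' v' x'"
    and coefficient: "coefficient X \<rho> v x x = coefficient X' \<rho>' v' x' x'"
  shows "unitarily_equivalent X \<rho> v x X' \<rho>' v' x'"
proof -
  interpret R: equivariant_rep \<alpha> \<sigma> X \<rho> v by fact
  interpret R': equivariant_rep \<alpha> \<sigma> X' \<rho>' v' by fact
  let ?e = "R.orbit x" and ?f = "R'.orbit x'"
  interpret equal_gram X X' ?e ?f
  proof
    show "total_family X ?e" "total_family X' ?f"
      using cyclic R.cyclic_iff_total[OF x] R'.cyclic_iff_total[OF x'] by auto
    show "hip X' (?f i) (?f j) = hip X (?e i) (?e j)" for i j
      by (cases i; cases j) (simp add: R.inner_orbit[OF x] R'.inner_orbit[OF x'] coefficient)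
  qed
  interpret flip: equal_gram X' X ?f ?e by (rule flip)
  let ?u = transport and ?u' = flip.transport
  have "\<rho>' a y = ?u (\<rho> a (?u' y))" if y: "y \<in> hcarrier X'" for a y
  proof (rule transport_unique[symmetric])
    note uy = flip.transport[OF y]
    show "\<rho> a (?u' y) \<in> hcarrier X" "\<rho>' a y \<in> hcarrier X'"
      by (intro R.rho_mem R'.rho_mem y uy)+
    show "hip X' (?f i) (\<rho>' a y) = hip X (?e i) (\<rho> a (?u' y))" for i
      by (cases i) (simp add: R.inner_rho_orbit R'.inner_rho_orbit x x' y uy)
  qed
  moreover have "v' h y = ?u (v h (?u' y))" if y: "y \<in> hcarrier X'" for h y
  proof (rule transport_unique[symmetric])
    note uy = flip.transport[OF y]
    show "v h (?u' y) \<in> hcarrier X" "v' h y \<in> hcarrier X'"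
      by (intro R.v_mem R'.v_mem y uy)+
    fix i :: "'g \<times> 'a"
    obtain g' a' where i: "i = (g', a')" by fastforce
    obtain g a where "g' = h + g" "a' = \<alpha> h a * \<sigma> h g" by (rule R.kernel_argument)
    then show "hip X' (?f i) (v' h y) = hip X (?e i) (v h (?u' y))"
      by (simp add: i R.inner_v_orbit R'.inner_v_orbit x x' y uy)
  qed
  moreover have "?u x = x'"
  proof (rule transport_unique[OF x x'])
    show "hip X' (?f i) x' = hip X (?e i) x" for i
      using gram[of i "(0, 1)"] by (simp add: R.orbit_unit R'.orbit_unit x x')
  qed
  ultimately show ?thesis
    unfolding unitarily_equivalent_def using is_unitary_transport by blast
qed

theorem theorem4p16:
  fixes \<alpha> :: "'g::group_add \<Rightarrow> 'a::unital_cstar_algebra \<Rightarrow> 'a"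
    and \<sigma> :: "'g \<Rightarrow> 'g \<Rightarrow> 'a"
    and T :: "'g \<Rightarrow> 'a \<Rightarrow> 'a"
  assumes "twisted_system \<alpha> \<sigma>"
    and "T \<in> L_maps"
    and "positive_definite \<alpha> \<sigma> T"
  shows
    "(\<exists>(X :: ('g \<Rightarrow> 'a \<Rightarrow> 'a, 'a) hmod) \<rho> v x.
        equivariant_rep \<alpha> \<sigma> X \<rho> v \<and> x \<in> hcarrier X \<and> T = coefficient X \<rho> v x x) \<and>
     (\<exists>(X :: ('g \<Rightarrow> 'a \<Rightarrow> 'a, 'a) hmod) \<rho> v x.
        equivariant_rep \<alpha> \<sigma> X \<rho> v \<and> x \<in> hcarrier X \<and> T = coefficient X \<rho> v x x \<and>
        cyclic X \<rho> v x) \<and>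
     (\<forall>(X :: ('x::ab_group_add, 'a) hmod) \<rho> v x (X' :: ('y::ab_group_add, 'a) hmod) \<rho>' v' x'.
        equivariant_rep \<alpha> \<sigma> X \<rho> v \<and> x \<in> hcarrier X \<and> T = coefficient X \<rho> v x x \<and>
        cyclic X \<rho> v x \<and>
        equivariant_rep \<alpha> \<sigma> X' \<rho>' v' \<and> x' \<in> hcarrier X' \<and> T = coefficient X' \<rho>' v' x' x' \<and>
        cyclic X' \<rho>' v' x' \<longrightarrow>
        unitarily_equivalent X \<rho> v x X' \<rho>' v' x')"
proof -
  interpret twisted_system \<alpha> \<sigma> by fact
  interpret positive_definite_map \<alpha> \<sigma> T by unfold_locales fact+
  interpret rep: equivariant_rep \<alpha> \<sigma> kernel_module left_mult translate
    by (rule equivariant_rep_kernel_module)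
  let ?x = "kernel_at (0, 1)"
  have x: "?x \<in> hcarrier kernel_module" by (rule span_subset[OF kernel_at_mem])
  have "rep.orbit ?x = kernel_at" by (auto simp: rep.orbit_def orbit_kernel_at)
  then have cyclic: "cyclic kernel_module left_mult translate ?x"
    using rep.cyclic_iff_total[OF x] total_kernel_at by simp
  show ?thesis
    using equivariant_rep_kernel_module x coefficient_kernel_at cyclic cyclic_unitarily_equivalent
    by (intro conjI allI impI) (blast | metis)+
qed

end
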